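(* Let $n\ge1$ and $m\in\{2n,2n+1\}$. The $W_t(j)$ coefficients for the $\mathrm{Cl}(m)$ quantum metric on $\mathcal{H}^{(n)}=(\mathbb{C}^2)^{\otimes n}$ are given by $$W_t(j)=\frac{(-1)^{tj}}{2^n}\sum_{s=0}^{t}(-1)^s\binom js\binom{m-j}{t-s}\qquad\text{for }0\le t,j\le r,$$ where $r$ is the diameter of the quantum metric ($r=2n$ if $m=2n$, and $r=n$ if $m=2n+1$).
   Context: Clifford quantum metrics: with Pauli matrices $\sigma_x,\sigma_y,\sigma_z$, put $U_k=\sigma_z^{\otimes k-1}\otimes\sigma_x\otimes I_2^{\otimes n-k}$ and $U_{n+k}=\sigma_z^{\otimes k-1}\otimes\sigma_y\otimes I_2^{\otimes n-k}$ for $1\le k\le n$, and $U_{2n+1}=\sigma_z^{\otimes n}$ (Hermitian, unitary, pairwise anticommuting). The $\mathrm{Cl}(m)$ quantum metric is $$\mathcal{E}_t^{\mathrm{Cl}(m)}=\operatorname{span}\{U_{k_1}\cdots U_{k_j}:1\le k_1<\dots<k_j\le m,\ 0\le j\le\lfloor t\rfloor\}$$ (empty product $=I$). The diameter is the smallest $r$ with $\mathcal{E}_r=\mathcal{L}(\mathcal{H}^{(n)})$. On $\mathcal{L}(\mathcal{H}^{(n)})$ use the Hilbert–Schmidt inner product $\operatorname{tr}(E^*F)$; put $\mathcal{V}_0=\mathbb{C}I$ and $\mathcal{V}_t=\mathcal{E}_t\cap\mathcal{E}_{t-1}^\perp$ for $1\le t\le r$. $W_t(j)$ coefficients: for $\mathcal{B}_t$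 any orthonormal basis of $\mathcal{V}_t$, let $\Phi_t(X)=\sum_{E\in\mathcal{B}_t}EXE^*$ and let $\Pi_t(X)=\sum_{E\in\mathcal{B}_t}\operatorname{tr}(E^*X)E$ (the orthogonal projection onto $\mathcal{V}_t$), as linear maps on the self-adjoint operators. The coefficients $W_t(j)\in\mathbb{R}$ are the unique numbers with $\Phi_t=\sum_{j=0}^{r}W_t(j)\Pi_j$ for $0\le t\le r$; equivalently $\Phi_t(X)=W_t(j)X$ for $X\in\mathcal{V}_j$ (such numbers exist for this metric). *)

theory Defs
  imports
    Complex_Main
    "Jordan_Normal_Form.VS_Connect"
    "Jordan_Normal_Form.Schur_Decomposition"
begin

text \<open>
  Operators on an \<open>N\<close>-dimensional Hilbert space are the elements of
  \<open>carrier_mat N N :: complex mat set\<close>; in particular \<open>N = 2 ^ n\<close> for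
  \<open>n\<close> qubits.
\<close>

abbreviation operator_space :: "nat \<Rightarrow> (complex, complex mat) module" where
  "operator_space N \<equiv> module_mat TYPE(complex) N N"

definition op_span :: "nat \<Rightarrow> complex mat set \<Rightarrow> complex mat set" where
  "op_span N = LinearCombinations.module.span class_ring (operator_space N)"

definition op_sum :: "nat \<Rightarrow> ('i \<Rightarrow> complex mat) \<Rightarrow> 'i set \<Rightarrow> complex mat" where
  "op_sum N = finsum (operator_space N)"

definition mat_trace :: "complex mat \<Rightarrow> complex" where
  "mat_trace A = (\<Sum>i<dim_row A. A $$ (i, i))"

definition hs_inner :: "complex mat \<Rightarrow> complex mat \<Rightarrow> complex" where
  "hs_inner E F = mat_trace (mat_adjoint E * F)"

definition self_adjoint :: "nat \<Rightarrow> complex mat set" where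
  "self_adjoint N = {X \<in> carrier_mat N N. mat_adjoint X = X}"

definition orthonormal_basis :: "nat \<Rightarrow> complex mat set \<Rightarrow> complex mat set \<Rightarrow> bool" where
  "orthonormal_basis N V B \<longleftrightarrow>
     B \<subseteq> carrier_mat N N \<and> op_span N B = V \<and>
     (\<forall>E\<in>B. \<forall>F\<in>B. hs_inner E F = (if E = F then 1 else 0))"

text \<open>
  A quantum metric is given by its filtration \<open>E\<close>, where \<open>E t\<close> is the space
  of operators of propagation at most \<open>t\<close>; only \<open>t \<ge> 0\<close> is relevant.
\<close>

definition qm_diameter :: "nat \<Rightarrow> (real \<Rightarrow> complex mat set) \<Rightarrow> real" where
  "qm_diameter N E = (LEAST t. 0 \<le> t \<and> E t = carrier_mat N N)"

definition qm_layer :: "nat \<Rightarrow> (real \<Rightarrow> complex mat set) \<Rightarrow> nat \<Rightarrow> complex mat set" where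
  "qm_layer N E t =
     (if t = 0 then op_span N {1\<^sub>m N}
      else {A \<in> E (real t). \<forall>F \<in> E (real t - 1). hs_inner F A = 0})"

definition error_map :: "nat \<Rightarrow> complex mat set \<Rightarrow> complex mat \<Rightarrow> complex mat" where
  "error_map N B X = op_sum N (\<lambda>E. E * X * mat_adjoint E) B"

definition proj_map :: "nat \<Rightarrow> complex mat set \<Rightarrow> complex mat \<Rightarrow> complex mat" where
  "proj_map N B X = op_sum N (\<lambda>E. hs_inner E X \<cdot>\<^sub>m E) B"

text \<open>
  For a metric \<open>E\<close> of diameter \<open>r\<close>, the real numbers \<open>W t j\<close> with
  \<open>0 \<le> t, j \<le> r\<close> are the \<open>W\<close>-coefficients if they satisfy the defining
  identities for every choice of orthonormal bases of the layers. The choice is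
  immaterial, since the maps involved do not depend on it.
  Entries of \<open>W\<close> outside this range are unconstrained.
\<close>

definition is_W_coefficients ::
    "nat \<Rightarrow> (real \<Rightarrow> complex mat set) \<Rightarrow> nat \<Rightarrow> (nat \<Rightarrow> nat \<Rightarrow> real) \<Rightarrow> bool" where
  "is_W_coefficients N E r W \<longleftrightarrow>
     (\<forall>B. (\<forall>j\<le>r. orthonormal_basis N (qm_layer N E j) (B j)) \<longrightarrow>
       (\<forall>t\<le>r. \<forall>X\<in>self_adjoint N.
          error_map N (B t) X =
            op_sum N (\<lambda>j. complex_of_real (W t j) \<cdot>\<^sub>m proj_map N (B j) X) {..r}))"

text \<open>Kronecker product; the left factor carries the most significant index.\<close>

definition kron :: "complex mat \<Rightarrow> complex mat \<Rightarrow> complex mat" where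
  "kron A B = mat (dim_row A * dim_row B) (dim_col A * dim_col B)
     (\<lambda>(i, j). A $$ (i div dim_row B, j div dim_col B)
             * B $$ (i mod dim_row B, j mod dim_col B))"

fun kron_pow :: "complex mat \<Rightarrow> nat \<Rightarrow> complex mat" where
  "kron_pow A 0 = 1\<^sub>m 1"
| "kron_pow A (Suc k) = kron A (kron_pow A k)"

definition pauli_x :: "complex mat" where
  "pauli_x = mat_of_rows_list 2 [[0, 1], [1, 0]]"

definition pauli_y :: "complex mat" where
  "pauli_y = mat_of_rows_list 2 [[0, - \<i>], [\<i>, 0]]"

definition pauli_z :: "complex mat" where
  "pauli_z = mat_of_rows_list 2 [[1, 0], [0, -1]]"

text \<open>
  The generators \<open>U\<^sub>1, \<dots>, U\<^bsub>2n+1\<^esub>\<close>; the value at any other index is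
  irrelevant.
\<close>

definition clifford_gen :: "nat \<Rightarrow> nat \<Rightarrow> complex mat" where
  "clifford_gen n k =
     (if k \<le> n then
        kron (kron (kron_pow pauli_z (k - 1)) pauli_x) (kron_pow (1\<^sub>m 2) (n - k))
      else if k \<le> 2 * n then
        kron (kron (kron_pow pauli_z (k - n - 1)) pauli_y) (kron_pow (1\<^sub>m 2) (2 * n - k))
      else kron_pow pauli_z n)"

definition clifford_word :: "nat \<Rightarrow> nat list \<Rightarrow> complex mat" where
  "clifford_word n ks = foldr (\<lambda>k A. clifford_gen n k * A) ks (1\<^sub>m (2 ^ n))"

definition clifford_metric :: "nat \<Rightarrow> nat \<Rightarrow> real \<Rightarrow> complex mat set" where
  "clifford_metric n m t =
     op_span (2 ^ n)
       {clifford_word n ks | ks.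
          sorted_wrt (<) ks \<and> set ks \<subseteq> {1..m} \<and> int (length ks) \<le> \<lfloor>t\<rfloor>}"

end

theory Submission
  imports Defs
begin

text \<open>
  Let \<open>U\<^sub>K\<close> be the product of the generators with index in \<open>K\<close>, in increasing order, for
  \<open>K \<subseteq> {1..m}\<close> with \<open>card K \<le> r\<close>. Distinct monomials are orthogonal, because some generator
  commutes with one and anticommutes with the other; there are \<open>4 ^ n\<close> of them, so they form
  an orthogonal basis of all operators, and the layer \<open>t\<close> is spanned by the \<open>U\<^sub>K\<close> with
  \<open>card K = t\<close>. Moving the generators past each other gives
  \<open>U\<^sub>K U\<^sub>J U\<^sub>K\<^sup>* = (-1) ^ (card K * card J - card (K \<inter> J)) U\<^sub>J\<close>, so the error map is diagonal in
  this basis. Counting the \<open>K\<close> with \<open>card K = t\<close> and \<open>card (K \<inter> J) = s\<close> gives the coefficients,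
  and they are unique since each \<open>U\<^sub>J\<close> has a self-adjoint multiple.
\<close>

section \<open>Operators and orthogonal bases\<close>

text \<open>For m = 2n + 1 the product of all generators commutes with each of them and is a scalar,
  so the monomials of K and of its complement are proportional. This is why the diameter drops to n
  and the index sets are cut off at \<open>card K \<le> r\<close>: one of every complementary pair
  remains. In the conjugation sign, \<open>card K * card J\<close> counts all pairs of letters as if
  each pair anticommuted, and \<open>card (K \<inter> J)\<close> takes back the coinciding ones;
  these terms become the factors (-1)^(tj) and (-1)^s. The factor 1/2^n is the reciprocal of the
  squared norm of a monomial. The delicate point is the quantification over orthonormal bases, which
  are bare sets of operators: their finiteness must be derived before a sum over them can be
  evaluated, the maps must be shown independent of the choice, and one choice must exist, or else
  every W would satisfy the defining condition.\<close>

lemma smult_smult_mat: "a \<cdot>\<^sub>m (b \<cdot>\<^sub>m A) = (a * b) \<cdot>\<^sub>m (A :: complex mat)"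
  by (intro eq_matI) auto

lemma one_smult_mat: "1 \<cdot>\<^sub>m A = (A :: complex mat)"
  by (intro eq_matI) auto

lemma op_sum_carrier:
  assumes "\<And>a. a \<in> A \<Longrightarrow> f a \<in> carrier_mat N N"
  shows "op_sum N f A \<in> carrier_mat N N"
proof -
  interpret matrix_vs N N "TYPE(complex)" .
  show ?thesis unfolding op_sum_def using assms by (intro finsum_closed) auto
qed

lemma op_sum_index:
  assumes "finite A" "\<And>a. a \<in> A \<Longrightarrow> f a \<in> carrier_mat N N" "i < N" "j < N"
  shows "op_sum N f A $$ (i, j) = (\<Sum>a\<in>A. f a $$ (i, j))"
  using assms(1,2)
proof (induction A rule: finite_induct)
  case empty
  interpret matrix_vs N N "TYPE(complex)" .
  show ?case using assms(3,4) by (simp add: op_sum_def)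
next
  case (insert a A)
  interpret matrix_vs N N "TYPE(complex)" .
  have "op_sum N f (insert a A) = f a + op_sum N f A"
    unfolding op_sum_def using insert.hyps insert.prems
    by (intro finsum_insert) (auto simp: Pi_def)
  moreover have "op_sum N f A \<in> carrier_mat N N"
    using insert.prems by (intro op_sum_carrier) auto
  ultimately show ?case using insert assms(3,4) by (simp add: sum.insert)
qed

lemma op_sum_smult_index:
  assumes "finite A" "\<And>a. a \<in> A \<Longrightarrow> f a \<in> carrier_mat N N" "i < N" "j < N"
  shows "op_sum N (\<lambda>a. c a \<cdot>\<^sub>m f a) A $$ (i, j) = (\<Sum>a\<in>A. c a * f a $$ (i, j))"
proof -
  have "(c a \<cdot>\<^sub>m f a) $$ (i, j) = c a * f a $$ (i, j)" if "a \<in> A" for a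
    using assms(2)[OF that] assms(3,4) by auto
  then show ?thesis using assms by (subst op_sum_index) auto
qed

lemma op_sum_cong:
  assumes "\<And>a. a \<in> A \<Longrightarrow> f a = g a" "\<And>a. a \<in> A \<Longrightarrow> g a \<in> carrier_mat N N"
  shows "op_sum N f A = op_sum N g A"
proof -
  interpret matrix_vs N N "TYPE(complex)" .
  show ?thesis unfolding op_sum_def using assms by (intro finsum_cong') auto
qed

lemma op_span_finite:
  assumes "finite S" "S \<subseteq> carrier_mat N N"
  shows "op_span N S = range (\<lambda>c. op_sum N (\<lambda>E. c E \<cdot>\<^sub>m E) S)"
proof -
  interpret matrix_vs N N "TYPE(complex)" .
  show ?thesis
    using finite_span[OF assms] by (auto simp: op_span_def op_sum_def lincomb_def)
qed

lemma op_span_carrier: "S \<subseteq> carrier_mat N N \<Longrightarrow> op_span N S \<subseteq> carrier_mat N N"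
proof -
  interpret matrix_vs N N "TYPE(complex)" .
  show "S \<subseteq> carrier_mat N N \<Longrightarrow> op_span N S \<subseteq> carrier_mat N N"
    unfolding op_span_def by auto
qed

lemma op_span_superset: "S \<subseteq> carrier_mat N N \<Longrightarrow> S \<subseteq> op_span N S"
proof -
  interpret matrix_vs N N "TYPE(complex)" .
  show "S \<subseteq> carrier_mat N N \<Longrightarrow> S \<subseteq> op_span N S"
    unfolding op_span_def by (rule in_own_span)
qed

lemma op_span_scaled:
  assumes "S \<subseteq> carrier_mat N N" "a \<noteq> 0" "finite S"
  shows "op_span N ((\<lambda>E. a \<cdot>\<^sub>m E) ` S) = op_span N S"
proof -
  interpret matrix_vs N N "TYPE(complex)" .
  have inj: "inj_on (\<lambda>E. a \<cdot>\<^sub>m E) S"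
  proof (rule inj_onI)
    fix E F assume "E \<in> S" "F \<in> S" and eq: "a \<cdot>\<^sub>m E = a \<cdot>\<^sub>m F"
    have "inverse a \<cdot>\<^sub>m (a \<cdot>\<^sub>m E) = inverse a \<cdot>\<^sub>m (a \<cdot>\<^sub>m F)" using eq by simp
    then show "E = F" using assms(2) by (auto simp: smult_smult_mat mat_eq_iff)
  qed
  have reindex: "op_sum N (\<lambda>E. c E \<cdot>\<^sub>m E) ((\<lambda>E. a \<cdot>\<^sub>m E) ` S)
      = op_sum N (\<lambda>E. (c (a \<cdot>\<^sub>m E) * a) \<cdot>\<^sub>m E) S" for c
    unfolding op_sum_def using assms(1) inj
    by (subst finsum_reindex) (auto simp: smult_smult_mat intro!: finsum_cong')
  have sub: "(\<lambda>E. a \<cdot>\<^sub>m E) ` S \<subseteq> carrier_mat N N" using assms(1) by auto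
  \<comment> \<open>Coefficients are functions of the matrix itself, so besides dividing by
    \<open>a\<close> the argument has to be scaled back.\<close>
  have unscale: "\<exists>c'. op_sum N (\<lambda>E. c E \<cdot>\<^sub>m E) S = op_sum N (\<lambda>E. c' E \<cdot>\<^sub>m E) ((\<lambda>E. a \<cdot>\<^sub>m E) ` S)" for c
  proof -
    have "c (inverse a \<cdot>\<^sub>m (a \<cdot>\<^sub>m E)) * inverse a * a = c E" if "E \<in> S" for E
      using assms(2) by (simp add: smult_smult_mat one_smult_mat)
    then show ?thesis
      using assms(1)
      by (intro exI[of _ "\<lambda>E. c (inverse a \<cdot>\<^sub>m E) * inverse a"])
        (subst reindex, auto intro!: op_sum_cong)
  qed
  show ?thesis
    unfolding op_span_finite[OF assms(3,1)] op_span_finite[OF finite_imageI[OF assms(3)] sub]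
    using reindex unscale by (auto simp: image_iff)
qed

section \<open>Adjoints, traces and the Hilbert-Schmidt inner product\<close>

lemma mat_adjoint_dim [simp]:
  "dim_row (mat_adjoint A) = dim_col A" "dim_col (mat_adjoint A) = dim_row A"
  by (simp_all add: mat_adjoint_def)

lemma mat_adjoint_carrier [simp]:
  assumes "A \<in> carrier_mat p q"
  shows "mat_adjoint A \<in> carrier_mat q p"
  using carrier_matD[OF assms] by (intro carrier_matI) simp_all

lemma mat_adjoint_index [simp]:
  fixes A :: "complex mat"
  shows "i < dim_col A \<Longrightarrow> j < dim_row A \<Longrightarrow> mat_adjoint A $$ (i, j) = cnj (A $$ (j, i))"
  by (simp add: mat_adjoint_def mat_of_rows_def)

lemma mat_adjoint_mult:
  fixes A B :: "complex mat"
  assumes "A \<in> carrier_mat p q" "B \<in> carrier_mat q s"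
  shows "mat_adjoint (A * B) = mat_adjoint B * mat_adjoint A"
proof (rule eq_matI)
  fix i j assume "i < dim_row (mat_adjoint B * mat_adjoint A)" "j < dim_col (mat_adjoint B * mat_adjoint A)"
  then have ij: "i < s" "j < p" using assms by simp_all
  have dims: "dim_row A = p" "dim_col A = q" "dim_row B = q" "dim_col B = s" using assms by auto
  have "mat_adjoint (A * B) $$ (i, j) = (\<Sum>k<q. cnj (A $$ (j, k) * B $$ (k, i)))"
    using ij by (simp add: dims scalar_prod_def atLeast0LessThan)
  also have "\<dots> = (\<Sum>k<q. cnj (B $$ (k, i)) * cnj (A $$ (j, k)))"
    by (intro sum.cong refl) simp
  also have "\<dots> = (mat_adjoint B * mat_adjoint A) $$ (i, j)"
    using ij by (simp add: dims scalar_prod_def atLeast0LessThan)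
  finally show "mat_adjoint (A * B) $$ (i, j) = (mat_adjoint B * mat_adjoint A) $$ (i, j)" .
qed (use assms in simp_all)

lemma mat_adjoint_smult: "mat_adjoint (c \<cdot>\<^sub>m A) = cnj c \<cdot>\<^sub>m mat_adjoint (A :: complex mat)"
  by (intro eq_matI) auto

lemma mat_adjoint_one: "mat_adjoint (1\<^sub>m N) = (1\<^sub>m N :: complex mat)"
  by (intro eq_matI) auto

lemma mat_trace_mult:
  assumes "A \<in> carrier_mat p q" "B \<in> carrier_mat q p"
  shows "mat_trace (A * B) = (\<Sum>i<p. \<Sum>j<q. A $$ (i, j) * B $$ (j, i))"
proof -
  have dims: "dim_row A = p" "dim_col A = q" "dim_row B = q" "dim_col B = p" using assms by auto
  show ?thesis
    unfolding mat_trace_def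
    by (intro sum.cong) (simp_all add: dims scalar_prod_def atLeast0LessThan)
qed

lemma mat_trace_comm:
  assumes "A \<in> carrier_mat N N" "B \<in> carrier_mat N N"
  shows "mat_trace (A * B) = mat_trace (B * A)"
proof -
  have "mat_trace (A * B) = (\<Sum>j<N. \<Sum>i<N. A $$ (i, j) * B $$ (j, i))"
    unfolding mat_trace_mult[OF assms] by (rule sum.swap)
  also have "\<dots> = mat_trace (B * A)"
    unfolding mat_trace_mult[OF assms(2,1)] by (intro sum.cong refl) simp
  finally show ?thesis .
qed

lemma hs_inner_entries:
  assumes "E \<in> carrier_mat N N" "F \<in> carrier_mat N N"
  shows "hs_inner E F = (\<Sum>i<N. \<Sum>j<N. cnj (E $$ (i, j)) * F $$ (i, j))"
proof -
  have dims: "dim_row E = N" "dim_col E = N" using assms by auto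
  have "hs_inner E F = (\<Sum>j<N. \<Sum>i<N. mat_adjoint E $$ (j, i) * F $$ (i, j))"
    unfolding hs_inner_def using assms by (intro mat_trace_mult) auto
  also have "\<dots> = (\<Sum>j<N. \<Sum>i<N. cnj (E $$ (i, j)) * F $$ (i, j))"
    by (intro sum.cong refl) (simp add: dims)
  also have "\<dots> = (\<Sum>i<N. \<Sum>j<N. cnj (E $$ (i, j)) * F $$ (i, j))" by (rule sum.swap)
  finally show ?thesis .
qed

lemma hs_inner_commute:
  assumes "E \<in> carrier_mat N N" "F \<in> carrier_mat N N"
  shows "hs_inner F E = cnj (hs_inner E F)"
  unfolding hs_inner_entries[OF assms] hs_inner_entries[OF assms(2,1)] cnj_sum
  by (intro sum.cong refl) simp

lemma hs_inner_smult_right: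
  assumes "E \<in> carrier_mat N N" "F \<in> carrier_mat N N"
  shows "hs_inner E (c \<cdot>\<^sub>m F) = c * hs_inner E F"
proof -
  have "hs_inner E (c \<cdot>\<^sub>m F) = (\<Sum>i<N. \<Sum>j<N. cnj (E $$ (i, j)) * (c \<cdot>\<^sub>m F) $$ (i, j))"
    using assms by (intro hs_inner_entries) auto
  also have "\<dots> = (\<Sum>i<N. \<Sum>j<N. c * (cnj (E $$ (i, j)) * F $$ (i, j)))"
    using assms(2) by (intro sum.cong refl) auto
  finally show ?thesis by (simp only: hs_inner_entries[OF assms] sum_distrib_left)
qed

lemma hs_inner_smult_left:
  assumes "E \<in> carrier_mat N N" "F \<in> carrier_mat N N"
  shows "hs_inner (c \<cdot>\<^sub>m E) F = cnj c * hs_inner E F"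
  unfolding hs_inner_commute[OF assms(2) smult_carrier_mat[OF assms(1)]]
    hs_inner_commute[OF assms(2,1)] hs_inner_smult_right[OF assms(2,1)] by simp

lemma hs_inner_op_sum_right:
  assumes "finite A" "E \<in> carrier_mat N N" "\<And>a. a \<in> A \<Longrightarrow> f a \<in> carrier_mat N N"
  shows "hs_inner E (op_sum N f A) = (\<Sum>a\<in>A. hs_inner E (f a))"
proof -
  have "hs_inner E (op_sum N f A) = (\<Sum>i<N. \<Sum>j<N. cnj (E $$ (i, j)) * op_sum N f A $$ (i, j))"
    using assms by (intro hs_inner_entries op_sum_carrier)
  also have "\<dots> = (\<Sum>i<N. \<Sum>j<N. \<Sum>a\<in>A. cnj (E $$ (i, j)) * f a $$ (i, j))"
    using op_sum_index[OF assms(1,3)] by (intro sum.cong refl) (simp add: sum_distrib_left)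
  also have "\<dots> = (\<Sum>i<N. \<Sum>a\<in>A. \<Sum>j<N. cnj (E $$ (i, j)) * f a $$ (i, j))"
    by (intro sum.cong refl sum.swap)
  also have "\<dots> = (\<Sum>a\<in>A. \<Sum>i<N. \<Sum>j<N. cnj (E $$ (i, j)) * f a $$ (i, j))"
    by (rule sum.swap)
  also have "\<dots> = (\<Sum>a\<in>A. hs_inner E (f a))"
    using hs_inner_entries[OF assms(2,3)] by (intro sum.cong refl) simp
  finally show ?thesis .
qed

section \<open>Flattened indices and the completeness relation\<close>

lemma mult_index_bounds:
  fixes i a b :: nat
  assumes "i < a * b"
  shows "i div b < a" "i mod b < b"
  using assms by (cases "b = 0"; simp add: less_mult_imp_div_less)+

text \<open>Row-major flattening of a pair to \<open>i * N + j\<close>. It serves both to view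
  operators as vectors of length \<open>N * N\<close> and to split the summation index of a
  Kronecker product.\<close>

lemma sum_product_index:
  fixes f :: "nat \<Rightarrow> nat \<Rightarrow> 'a::comm_monoid_add"
  shows "(\<Sum>q<M * N. f (q div N) (q mod N)) = (\<Sum>i<M. \<Sum>j<N. f i j)"
proof -
  have "(\<Sum>q<M * N. f (q div N) (q mod N)) = (\<Sum>(i, j)\<in>{..<M} \<times> {..<N}. f i j)"
  proof (rule sum.reindex_bij_witness[of _ "\<lambda>(i, j). i * N + j" "\<lambda>q. (q div N, q mod N)"])
    fix q assume "q \<in> {..<M * N}"
    then show "(q div N, q mod N) \<in> {..<M} \<times> {..<N}"
      using mult_index_bounds[of q M N] by simp
  next
    fix b assume "b \<in> {..<M} \<times> {..<N}"
    then obtain i j where b: "b = (i, j)" "i < M" "j < N" by auto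
    have "i * N + j < Suc i * N" using b by simp
    also have "\<dots> \<le> M * N" using b by (intro mult_right_mono) auto
    finally show "(case b of (i, j) \<Rightarrow> i * N + j) \<in> {..<M * N}" using b by simp
  qed auto
  then show ?thesis by (simp add: sum.cartesian_product)
qed

text \<open>
  Stacking the flattened \<open>N\<^sup>2\<close> matrices as rows gives a square matrix with a one-sided
  inverse; that this inverse is two-sided is the completeness relation.
\<close>
lemma orthogonal_family_completeness:
  assumes card: "card I = N * N" and d: "d \<noteq> 0"
    and F: "\<And>i. i \<in> I \<Longrightarrow> F i \<in> carrier_mat N N"
    and orth: "\<And>i j. i \<in> I \<Longrightarrow> j \<in> I \<Longrightarrow> hs_inner (F i) (F j) = (if i = j then d else 0)"
    and fin: "finite I"
    and idx: "a < N" "b < N" "a' < N" "b' < N"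
  shows "(\<Sum>i\<in>I. F i $$ (a, b) * cnj (F i $$ (a', b'))) = (if a = a' \<and> b = b' then d else 0)"
proof -
  obtain h where h: "bij_betw h {..<N * N} I"
    using ex_bij_betw_nat_finite[OF fin] card by (auto simp: atLeast0LessThan)
  define P where "P = mat (N * N) (N * N) (\<lambda>(p, q). cnj (F (h p) $$ (q div N, q mod N)))"
  define Q where "Q = mat (N * N) (N * N) (\<lambda>(q, p). F (h p) $$ (q div N, q mod N) / d)"
  have PQc: "P \<in> carrier_mat (N * N) (N * N)" "Q \<in> carrier_mat (N * N) (N * N)"
    by (auto simp: P_def Q_def)
  have "P * Q = 1\<^sub>m (N * N)"
  proof (rule eq_matI)
    fix p p' assume "p < dim_row (1\<^sub>m (N * N))" "p' < dim_col (1\<^sub>m (N * N))"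
    then have p: "p < N * N" "p' < N * N" by auto
    then have hI: "h p \<in> I" "h p' \<in> I" using h by (auto simp: bij_betw_def)
    have "(P * Q) $$ (p, p') =
        (\<Sum>q<N * N. cnj (F (h p) $$ (q div N, q mod N)) * F (h p') $$ (q div N, q mod N)) / d"
      using p by (simp add: P_def Q_def scalar_prod_def atLeast0LessThan sum_divide_distrib)
    also have "\<dots> = hs_inner (F (h p)) (F (h p')) / d"
      using hs_inner_entries[OF F F, OF hI]
        sum_product_index[of "\<lambda>i j. cnj (F (h p) $$ (i, j)) * F (h p') $$ (i, j)" N N] by simp
    also have "\<dots> = (if h p = h p' then 1 else 0)" using orth[OF hI] d by simp
    also have "h p = h p' \<longleftrightarrow> p = p'"
      using h p by (auto simp: bij_betw_def inj_on_def)
    finally show "(P * Q) $$ (p, p') = 1\<^sub>m (N * N) $$ (p, p')" using p by simp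
  qed (use PQc in auto)
  then have QP: "Q * P = 1\<^sub>m (N * N)" using mat_mult_left_right_inverse PQc by blast
  have code: "i * N + j < N * N" "(i * N + j) div N = i" "(i * N + j) mod N = j"
    if "i < N" "j < N" for i j
  proof -
    have "i * N + j < Suc i * N" using that by simp
    also have "\<dots> \<le> N * N" using that by (intro mult_right_mono) auto
    finally show "i * N + j < N * N" .
  qed (use that in auto)
  let ?q = "a * N + b" and ?q' = "a' * N + b'"
  have "(\<Sum>i\<in>I. F i $$ (a, b) * cnj (F i $$ (a', b')))
      = (\<Sum>p<N * N. F (h p) $$ (a, b) * cnj (F (h p) $$ (a', b')))"
    by (rule sum.reindex_bij_betw[OF h, symmetric])
  also have "\<dots> = d * (Q * P) $$ (?q, ?q')"
    using code[of a b] code[of a' b'] idx d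
    by (simp add: P_def Q_def scalar_prod_def atLeast0LessThan sum_distrib_left)
  also have "\<dots> = (if ?q = ?q' then d else 0)"
    unfolding QP using code[of a b] code[of a' b'] idx by simp
  finally have *: "(\<Sum>i\<in>I. F i $$ (a, b) * cnj (F i $$ (a', b'))) = (if ?q = ?q' then d else 0)" .
  have "a = a' \<and> b = b'" if "?q = ?q'"
    using arg_cong[OF that, of "\<lambda>q. q div N"] arg_cong[OF that, of "\<lambda>q. q mod N"]
      code(2,3)[OF idx(1,2)] code(2,3)[OF idx(3,4)] by simp
  then have "?q = ?q' \<longleftrightarrow> a = a' \<and> b = b'" by blast
  then show ?thesis using * by simp
qed

text \<open>The members share a squared norm \<open>d\<close> that may differ from 1, so a family of
  unitaries qualifies without square roots. \<open>card_I\<close> asks for the full dimension of the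
  operator space, which turns orthogonality into a basis property.\<close>

locale orthogonal_frame =
  fixes N :: nat and d :: complex and I :: "'i set" and F :: "'i \<Rightarrow> complex mat"
  assumes finite_I: "finite I" and card_I: "card I = N * N" and d_nz: "d \<noteq> 0"
    and F_carrier: "\<And>i. i \<in> I \<Longrightarrow> F i \<in> carrier_mat N N"
    and F_orth: "\<And>i j. i \<in> I \<Longrightarrow> j \<in> I \<Longrightarrow> hs_inner (F i) (F j) = (if i = j then d else 0)"
begin

text \<open>Writing the inner products entrywise turns the right-hand side into X contracted with
  the kernel of the completeness relation, which picks out a single entry of X.\<close>

lemma expansion:
  assumes X: "X \<in> carrier_mat N N"
  shows "X = op_sum N (\<lambda>i. (hs_inner (F i) X / d) \<cdot>\<^sub>m F i) I" (is "_ = ?R")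
proof (rule eq_matI)
  have R: "?R \<in> carrier_mat N N" using F_carrier by (intro op_sum_carrier) auto
  then show "dim_row X = dim_row ?R" "dim_col X = dim_col ?R" using X by auto
  fix a b assume "a < dim_row ?R" "b < dim_col ?R"
  then have ab: "a < N" "b < N" using R by auto
  have "?R $$ (a, b) = (\<Sum>i\<in>I. hs_inner (F i) X / d * F i $$ (a, b))"
    using ab F_carrier finite_I by (simp add: op_sum_smult_index)
  also have "\<dots> = (\<Sum>i\<in>I. \<Sum>a'<N. \<Sum>b'<N. X $$ (a', b') / d * (F i $$ (a, b) * cnj (F i $$ (a', b'))))"
  proof (rule sum.cong[OF refl])
    fix i assume "i \<in> I"
    then have "hs_inner (F i) X / d * F i $$ (a, b)
        = (\<Sum>a'<N. \<Sum>b'<N. cnj (F i $$ (a', b')) * X $$ (a', b') / d * F i $$ (a, b))"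
      by (simp only: hs_inner_entries[OF F_carrier X] sum_divide_distrib sum_distrib_right)
    also have "\<dots> = (\<Sum>a'<N. \<Sum>b'<N. X $$ (a', b') / d * (F i $$ (a, b) * cnj (F i $$ (a', b'))))"
      by (intro sum.cong refl) simp
    finally show "hs_inner (F i) X / d * F i $$ (a, b)
        = (\<Sum>a'<N. \<Sum>b'<N. X $$ (a', b') / d * (F i $$ (a, b) * cnj (F i $$ (a', b'))))" .
  qed
  also have "\<dots> = (\<Sum>a'<N. \<Sum>i\<in>I. \<Sum>b'<N. X $$ (a', b') / d * (F i $$ (a, b) * cnj (F i $$ (a', b'))))"
    by (rule sum.swap)
  also have "\<dots> = (\<Sum>a'<N. \<Sum>b'<N. \<Sum>i\<in>I. X $$ (a', b') / d * (F i $$ (a, b) * cnj (F i $$ (a', b'))))"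
    by (intro sum.cong refl sum.swap)
  also have "\<dots> = (\<Sum>a'<N. \<Sum>b'<N. X $$ (a', b') / d * (if a = a' \<and> b = b' then d else 0))"
    unfolding sum_distrib_left[symmetric]
    using orthogonal_family_completeness[OF card_I d_nz F_carrier F_orth finite_I ab]
    by (intro sum.cong refl) simp
  also have "\<dots> = (\<Sum>a'<N. if a = a' then X $$ (a', b) else 0)"
    using ab d_nz by (intro sum.cong refl) (auto simp: if_distrib sum.delta cong: if_cong)
  also have "\<dots> = X $$ (a, b)" using ab by simp
  finally show "X $$ (a, b) = ?R $$ (a, b)" by simp
qed

lemma eq_zeroI:
  assumes "X \<in> carrier_mat N N" "\<And>i. i \<in> I \<Longrightarrow> hs_inner (F i) X = 0"
  shows "X = 0\<^sub>m N N"
proof (rule eq_matI)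
  fix a b assume ab: "a < dim_row (0\<^sub>m N N :: complex mat)" "b < dim_col (0\<^sub>m N N :: complex mat)"
  have "X $$ (a, b) = op_sum N (\<lambda>i. (hs_inner (F i) X / d) \<cdot>\<^sub>m F i) I $$ (a, b)"
    using expansion[OF assms(1)] by simp
  also have "\<dots> = 0"
    using ab assms F_carrier finite_I by (simp add: op_sum_smult_index)
  finally show "X $$ (a, b) = 0\<^sub>m N N $$ (a, b)" using ab by simp
qed (use assms in auto)

lemma inj_on_F: "inj_on F I"
proof (rule inj_onI)
  fix i j assume *: "i \<in> I" "j \<in> I" "F i = F j"
  then have "hs_inner (F i) (F j) = d" using F_orth[of i i] by simp
  then show "i = j" using F_orth[of i j] * d_nz by (auto split: if_splits)
qed

lemma op_sum_image:
  assumes "J \<subseteq> I" "\<And>i. i \<in> J \<Longrightarrow> g (F i) \<in> carrier_mat N N"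
  shows "op_sum N g (F ` J) = op_sum N (\<lambda>i. g (F i)) J"
proof -
  interpret matrix_vs N N "TYPE(complex)" .
  have "inj_on F J" using inj_on_F assms(1) by (rule inj_on_subset)
  then show ?thesis
    unfolding op_sum_def using assms(2) by (subst finsum_reindex) auto
qed

lemma expansion_on:
  assumes J: "J \<subseteq> I" and X: "X \<in> carrier_mat N N"
    and z: "\<And>i. i \<in> I - J \<Longrightarrow> hs_inner (F i) X = 0"
  shows "X = op_sum N (\<lambda>i. (hs_inner (F i) X / d) \<cdot>\<^sub>m F i) J" (is "_ = ?R")
proof (rule eq_matI)
  have fin: "finite J" and sub: "\<And>i. i \<in> J \<Longrightarrow> F i \<in> carrier_mat N N"
    using J finite_I finite_subset F_carrier by blast+
  have Rc: "?R \<in> carrier_mat N N" using sub by (intro op_sum_carrier) auto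
  then show "dim_row X = dim_row ?R" "dim_col X = dim_col ?R" using X by auto
  fix a b assume "a < dim_row ?R" "b < dim_col ?R"
  then have ab: "a < N" "b < N" using Rc by auto
  have "X $$ (a, b) = op_sum N (\<lambda>i. (hs_inner (F i) X / d) \<cdot>\<^sub>m F i) I $$ (a, b)"
    using expansion[OF X] by simp
  also have "\<dots> = (\<Sum>i\<in>I. hs_inner (F i) X / d * F i $$ (a, b))"
    using ab F_carrier finite_I by (simp add: op_sum_smult_index)
  also have "\<dots> = (\<Sum>i\<in>J. hs_inner (F i) X / d * F i $$ (a, b))"
    using z J finite_I by (intro sum.mono_neutral_right) auto
  also have "\<dots> = ?R $$ (a, b)"
    using ab sub fin by (simp add: op_sum_smult_index)
  finally show "X $$ (a, b) = ?R $$ (a, b)" .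
qed

text \<open>Turns a span into a system of vanishing coordinates. The filtration, its layers and the
  minimality of the diameter thereby reduce to statements about sets of indices.\<close>

lemma mem_span_iff:
  assumes "J \<subseteq> I"
  shows "X \<in> op_span N (F ` J) \<longleftrightarrow> X \<in> carrier_mat N N \<and> (\<forall>i\<in>I - J. hs_inner (F i) X = 0)"
proof -
  have fin: "finite J" using assms finite_I finite_subset by blast
  have FJ: "\<And>i. i \<in> J \<Longrightarrow> F i \<in> carrier_mat N N" using assms F_carrier by auto
  then have sub: "F ` J \<subseteq> carrier_mat N N" by auto
  note span = op_span_finite[OF finite_imageI[OF fin] sub]
  have image: "op_sum N (\<lambda>E. c E \<cdot>\<^sub>m E) (F ` J) = op_sum N (\<lambda>i. c (F i) \<cdot>\<^sub>m F i) J" for c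
    using op_sum_image[OF assms, of "\<lambda>E. c E \<cdot>\<^sub>m E"] FJ by simp
  show ?thesis
  proof
    assume X: "X \<in> op_span N (F ` J)"
    then obtain c where Xc: "X = op_sum N (\<lambda>i. c (F i) \<cdot>\<^sub>m F i) J" unfolding span image by auto
    have "hs_inner (F i) X = 0" if i: "i \<in> I - J" for i
    proof -
      have "hs_inner (F i) X = (\<Sum>j\<in>J. c (F j) * hs_inner (F i) (F j))"
        unfolding Xc using i FJ F_carrier fin
        by (subst hs_inner_op_sum_right) (auto simp: hs_inner_smult_right[where N = N])
      also have "\<dots> = 0"
      proof (rule sum.neutral, rule ballI)
        fix j assume "j \<in> J"
        then have "j \<in> I" "i \<noteq> j" using i assms by auto
        then show "c (F j) * hs_inner (F i) (F j) = 0" using F_orth[of i j] i by simp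
      qed
      finally show ?thesis .
    qed
    then show "X \<in> carrier_mat N N \<and> (\<forall>i\<in>I - J. hs_inner (F i) X = 0)"
      using op_span_carrier[OF sub] X by auto
  next
    assume R: "X \<in> carrier_mat N N \<and> (\<forall>i\<in>I - J. hs_inner (F i) X = 0)"
    then have "X = op_sum N (\<lambda>E. (hs_inner E X / d) \<cdot>\<^sub>m E) (F ` J)"
      unfolding image using expansion_on[OF assms] by blast
    then show "X \<in> op_span N (F ` J)"
      unfolding span by (rule range_eqI[where x = "\<lambda>E. hs_inner E X / d"])
  qed
qed

lemma span_I: "op_span N (F ` I) = carrier_mat N N"
  using mem_span_iff[of I] by auto

lemma F_in_span: "J \<subseteq> I \<Longrightarrow> i \<in> J \<Longrightarrow> F i \<in> op_span N (F ` J)"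
  unfolding mem_span_iff using F_carrier F_orth by auto

end

text \<open>On an infinite set \<open>op_sum\<close> has a default value unrelated to any sum, so
  infinite bases have to be excluded before \<open>error_map\<close> and \<open>proj_map\<close> can
  be expanded.\<close>

lemma orthonormal_finite:
  assumes B: "B \<subseteq> carrier_mat N N"
    and orth: "\<And>E F. E \<in> B \<Longrightarrow> F \<in> B \<Longrightarrow> hs_inner E F = (if E = F then 1 else 0)"
  shows "finite B"
proof (rule ccontr)
  assume inf: "infinite B"
  then obtain S where S: "S \<subseteq> B" "finite S" "card S = N * N"
    using infinite_arbitrarily_large[OF inf, of "N * N"] by auto
  \<comment> \<open>\<open>N * N\<close> of the members, indexed by themselves, already form a frame
    with \<open>d = 1\<close>; a further member is orthogonal to all of it and hence zero, although
    its norm is 1.\<close>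
  interpret orthogonal_frame N 1 S "\<lambda>E. E"
    using S B by unfold_locales (auto intro!: orth[THEN trans])
  obtain E where E: "E \<in> B" "E \<notin> S" using inf S by (metis finite_subset subsetI)
  have "E = 0\<^sub>m N N"
    using E S B orth by (intro eq_zeroI) (auto simp: subset_iff)
  then have "hs_inner E E = 0" by (simp add: hs_inner_entries[where N = N])
  then show False using orth[OF E(1) E(1)] by simp
qed

lemma orthonormal_basis_finite: "orthonormal_basis N V B \<Longrightarrow> finite B"
  by (rule orthonormal_finite) (auto simp: orthonormal_basis_def)

lemma orthonormal_basis_expansion:
  assumes ob: "orthonormal_basis N V B" and X: "X \<in> V"
  shows "X = op_sum N (\<lambda>E. hs_inner E X \<cdot>\<^sub>m E) B"
proof -
  have fin: "finite B" using ob by (rule orthonormal_basis_finite)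
  have B: "B \<subseteq> carrier_mat N N" and V: "op_span N B = V"
    and orth: "\<And>E F. E \<in> B \<Longrightarrow> F \<in> B \<Longrightarrow> hs_inner E F = (if E = F then 1 else 0)"
    using ob by (auto simp: orthonormal_basis_def)
  obtain c where c: "X = op_sum N (\<lambda>E. c E \<cdot>\<^sub>m E) B"
    using X V op_span_finite[OF fin B] by auto
  have "hs_inner E X = c E" if E: "E \<in> B" for E
  proof -
    have "hs_inner E X = (\<Sum>F\<in>B. c F * hs_inner E F)"
      unfolding c using B E fin
      by (subst hs_inner_op_sum_right) (auto simp: hs_inner_smult_right[where N = N] subset_iff intro!: sum.cong)
    also have "\<dots> = (\<Sum>F\<in>B. if F = E then c F else 0)"
      using orth E by (intro sum.cong) auto
    finally show ?thesis using E fin by simp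
  qed
  then show ?thesis unfolding c[symmetric]
    by (subst c, intro op_sum_cong) (use B in auto)
qed

context orthogonal_frame
begin

text \<open>
  Both \<open>error_map\<close> and \<open>proj_map\<close> depend on the basis only through this kernel.
\<close>
lemma orthonormal_basis_kernel:
  assumes J: "J \<subseteq> I" and ob: "orthonormal_basis N (op_span N (F ` J)) B"
    and idx: "a < N" "b < N" "a' < N" "b' < N"
  shows "(\<Sum>E\<in>B. E $$ (a, b) * cnj (E $$ (a', b')))
       = (\<Sum>i\<in>J. F i $$ (a, b) * cnj (F i $$ (a', b'))) / d"
proof -
  have fin: "finite B" using ob by (rule orthonormal_basis_finite)
  have B: "\<And>E. E \<in> B \<Longrightarrow> E \<in> carrier_mat N N" and BJ: "\<And>E. E \<in> B \<Longrightarrow> E \<in> op_span N (F ` J)"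
    using ob op_span_superset[of B N] by (auto simp: orthonormal_basis_def)
  have finJ: "finite J" and FJ: "\<And>i. i \<in> J \<Longrightarrow> F i \<in> carrier_mat N N"
    using J finite_I finite_subset F_carrier by blast+
  \<comment> \<open>Only the unconjugated factor is expanded in the frame. The other one is kept, so
    that the sum over \<open>B\<close> of \<open>hs_inner E (F i)\<close> times E can be recombined
    to \<open>F i\<close>.\<close>
  have "E $$ (a, b) * cnj (E $$ (a', b'))
      = (\<Sum>i\<in>J. F i $$ (a, b) / d * cnj (hs_inner E (F i) * E $$ (a', b')))" if E: "E \<in> B" for E
  proof -
    have "E = op_sum N (\<lambda>i. (hs_inner (F i) E / d) \<cdot>\<^sub>m F i) J"
      using BJ[OF E] mem_span_iff[OF J] by (intro expansion_on[OF J]) auto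
    then have "E $$ (a, b) = op_sum N (\<lambda>i. (hs_inner (F i) E / d) \<cdot>\<^sub>m F i) J $$ (a, b)"
      by (rule arg_cong)
    also have "\<dots> = (\<Sum>i\<in>J. hs_inner (F i) E / d * F i $$ (a, b))"
      using finJ FJ idx by (simp add: op_sum_smult_index)
    also have "\<dots> = (\<Sum>i\<in>J. F i $$ (a, b) / d * cnj (hs_inner E (F i)))"
      using hs_inner_commute[OF B[OF E] FJ] by (intro sum.cong refl) simp
    finally show ?thesis by (simp add: sum_distrib_right mult.assoc)
  qed
  then have "(\<Sum>E\<in>B. E $$ (a, b) * cnj (E $$ (a', b')))
      = (\<Sum>E\<in>B. \<Sum>i\<in>J. F i $$ (a, b) / d * cnj (hs_inner E (F i) * E $$ (a', b')))"
    by (rule sum.cong[OF refl])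
  also have "\<dots> = (\<Sum>i\<in>J. F i $$ (a, b) / d * cnj (\<Sum>E\<in>B. hs_inner E (F i) * E $$ (a', b')))"
    by (subst sum.swap) (simp add: sum_distrib_left)
  also have "\<dots> = (\<Sum>i\<in>J. F i $$ (a, b) / d * cnj (F i $$ (a', b')))"
  proof (intro sum.cong refl)
    fix i assume i: "i \<in> J"
    have "F i $$ (a', b') = op_sum N (\<lambda>E. hs_inner E (F i) \<cdot>\<^sub>m E) B $$ (a', b')"
      using orthonormal_basis_expansion[OF ob F_in_span[OF J i]] by simp
    also have "\<dots> = (\<Sum>E\<in>B. hs_inner E (F i) * E $$ (a', b'))"
      using idx B fin by (simp add: op_sum_smult_index)
    finally show "F i $$ (a, b) / d * cnj (\<Sum>E\<in>B. hs_inner E (F i) * E $$ (a', b'))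
        = F i $$ (a, b) / d * cnj (F i $$ (a', b'))" by simp
  qed
  finally show ?thesis by (simp add: sum_divide_distrib)
qed

end

section \<open>The error and projection maps in terms of a frame\<close>

lemma triple_mult_index:
  assumes A: "A \<in> carrier_mat N N" and X: "X \<in> carrier_mat N N" and B: "B \<in> carrier_mat N N"
    and ab: "a < N" "b < N"
  shows "(A * X * B) $$ (a, b) = (\<Sum>e<N. \<Sum>c<N. A $$ (a, c) * X $$ (c, e) * B $$ (e, b))"
proof -
  note dims = carrier_matD[OF A] carrier_matD[OF X] carrier_matD[OF B]
  show ?thesis
    using ab by (simp add: dims scalar_prod_def atLeast0LessThan sum_distrib_right)
qed

lemma sandwich_carrier:
  fixes E :: "complex mat"
  assumes "E \<in> carrier_mat N N" "X \<in> carrier_mat N N"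
  shows "E * X * mat_adjoint E \<in> carrier_mat N N"
  by (rule mult_carrier_mat[OF mult_carrier_mat[OF assms] mat_adjoint_carrier[OF assms(1)]])

lemma mult_op_sum_mult:
  assumes fin: "finite I" and f: "\<And>i. i \<in> I \<Longrightarrow> f i \<in> carrier_mat N N"
    and A: "A \<in> carrier_mat N N" and B: "B \<in> carrier_mat N N"
  shows "A * op_sum N f I * B = op_sum N (\<lambda>i. A * f i * B) I"
proof (rule eq_matI)
  have S: "op_sum N f I \<in> carrier_mat N N" using f by (rule op_sum_carrier)
  have g: "A * f i * B \<in> carrier_mat N N" if "i \<in> I" for i using A B f[OF that] by auto
  note R = op_sum_carrier[OF g, of I "\<lambda>i. i"]
  show "dim_row (A * op_sum N f I * B) = dim_row (op_sum N (\<lambda>i. A * f i * B) I)"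
    "dim_col (A * op_sum N f I * B) = dim_col (op_sum N (\<lambda>i. A * f i * B) I)"
    using carrier_matD[OF A] carrier_matD[OF B] carrier_matD[OF R] by simp_all
  fix a b assume "a < dim_row (op_sum N (\<lambda>i. A * f i * B) I)" "b < dim_col (op_sum N (\<lambda>i. A * f i * B) I)"
  then have ab: "a < N" "b < N" using carrier_matD[OF R] by simp_all
  have "(A * op_sum N f I * B) $$ (a, b)
      = (\<Sum>e<N. \<Sum>c<N. \<Sum>i\<in>I. A $$ (a, c) * f i $$ (c, e) * B $$ (e, b))"
    unfolding triple_mult_index[OF A S B ab]
    by (intro sum.cong refl) (simp add: op_sum_index[OF fin f] sum_distrib_left sum_distrib_right)
  also have "\<dots> = (\<Sum>e<N. \<Sum>i\<in>I. \<Sum>c<N. A $$ (a, c) * f i $$ (c, e) * B $$ (e, b))"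
    by (intro sum.cong refl sum.swap)
  also have "\<dots> = (\<Sum>i\<in>I. \<Sum>e<N. \<Sum>c<N. A $$ (a, c) * f i $$ (c, e) * B $$ (e, b))"
    by (rule sum.swap)
  also have "\<dots> = (\<Sum>i\<in>I. (A * f i * B) $$ (a, b))"
    using triple_mult_index[OF A f B ab] by (intro sum.cong refl) simp
  also have "\<dots> = op_sum N (\<lambda>i. A * f i * B) I $$ (a, b)"
    by (rule op_sum_index[OF fin g ab, symmetric])
  finally show "(A * op_sum N f I * B) $$ (a, b) = op_sum N (\<lambda>i. A * f i * B) I $$ (a, b)" .
qed

lemma op_sum_eqI:
  assumes "M \<in> carrier_mat N N" "finite A" "\<And>a. a \<in> A \<Longrightarrow> f a \<in> carrier_mat N N"
    and "\<And>i j. i < N \<Longrightarrow> j < N \<Longrightarrow> M $$ (i, j) = (\<Sum>a\<in>A. f a $$ (i, j))"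
  shows "M = op_sum N f A"
proof (rule eq_matI)
  note R = op_sum_carrier[of A f N, OF assms(3)]
  show "dim_row M = dim_row (op_sum N f A)" "dim_col M = dim_col (op_sum N f A)"
    using carrier_matD[OF assms(1)] carrier_matD[OF R] by simp_all
  fix i j assume "i < dim_row (op_sum N f A)" "j < dim_col (op_sum N f A)"
  then have "i < N" "j < N" using carrier_matD[OF R] by simp_all
  then show "M $$ (i, j) = op_sum N f A $$ (i, j)"
    using assms(4) op_sum_index[of A f N i j, OF assms(2,3)] by simp
qed

context orthogonal_frame
begin

lemma orthogonal_to_span_iff:
  assumes J: "J \<subseteq> I" and A: "A \<in> carrier_mat N N"
  shows "(\<forall>E\<in>op_span N (F ` J). hs_inner E A = 0) \<longleftrightarrow> (\<forall>i\<in>J. hs_inner (F i) A = 0)"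
proof
  show "\<forall>i\<in>J. hs_inner (F i) A = 0" if "\<forall>E\<in>op_span N (F ` J). hs_inner E A = 0"
    using that F_in_span[OF J] by blast
next
  assume z: "\<forall>i\<in>J. hs_inner (F i) A = 0"
  have fin: "finite J" and FJ: "\<And>i. i \<in> J \<Longrightarrow> F i \<in> carrier_mat N N"
    using J finite_I finite_subset F_carrier by blast+
  show "\<forall>E\<in>op_span N (F ` J). hs_inner E A = 0"
  proof
    fix E assume E: "E \<in> op_span N (F ` J)"
    then have Ec: "E = op_sum N (\<lambda>i. (hs_inner (F i) E / d) \<cdot>\<^sub>m F i) J"
      unfolding mem_span_iff[OF J] by (intro expansion_on[OF J]) auto
    have "hs_inner A (op_sum N (\<lambda>i. c i \<cdot>\<^sub>m F i) J) = 0" for c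
    proof -
      have "hs_inner A (op_sum N (\<lambda>i. c i \<cdot>\<^sub>m F i) J) = (\<Sum>i\<in>J. hs_inner A (c i \<cdot>\<^sub>m F i))"
        using fin A FJ by (intro hs_inner_op_sum_right) auto
      also have "\<dots> = 0"
        using z hs_inner_commute[OF FJ A] by (intro sum.neutral ballI) (simp add: hs_inner_smult_right[OF A FJ])
      finally show ?thesis .
    qed
    then have "hs_inner A E = 0" using Ec by metis
    moreover have "E \<in> carrier_mat N N" using E mem_span_iff[OF J] by blast
    ultimately show "hs_inner E A = 0" using hs_inner_commute[OF A] by simp
  qed
qed

lemma hs_inner_combination:
  assumes "k \<in> I"
  shows "hs_inner (F k) (op_sum N (\<lambda>i. x i \<cdot>\<^sub>m F i) I) = x k * d"
proof -
  have "hs_inner (F k) (op_sum N (\<lambda>i. x i \<cdot>\<^sub>m F i) I) = (\<Sum>i\<in>I. hs_inner (F k) (x i \<cdot>\<^sub>m F i))"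
    using F_carrier assms finite_I by (intro hs_inner_op_sum_right) auto
  also have "\<dots> = (\<Sum>i\<in>I. if i = k then x i * d else 0)"
    using F_orth assms by (intro sum.cong refl) (simp add: hs_inner_smult_right[OF F_carrier F_carrier])
  finally show ?thesis using assms finite_I by simp
qed

context
  fixes J B
  assumes J: "J \<subseteq> I" and ob: "orthonormal_basis N (op_span N (F ` J)) B"
begin

lemma sub_frame:
  "finite J" "\<And>i. i \<in> J \<Longrightarrow> F i \<in> carrier_mat N N" "finite B" "\<And>E. E \<in> B \<Longrightarrow> E \<in> carrier_mat N N"
  using J finite_I finite_subset F_carrier orthonormal_basis_finite[OF ob] ob
  by (blast, blast, blast, auto simp: orthonormal_basis_def)

text \<open>Every entry of the error map is linear in the kernel
  \<open>E $$ (a, c) * cnj (E $$ (b, e))\<close> summed over the basis, so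
  \<open>orthonormal_basis_kernel\<close> replaces the unknown basis by the frame at the cost of
  \<open>1 / d\<close>.\<close>

lemma error_map_frame:
  assumes X: "X \<in> carrier_mat N N"
  shows "error_map N B X = op_sum N (\<lambda>i. (1 / d) \<cdot>\<^sub>m (F i * X * mat_adjoint (F i))) J"
proof (rule op_sum_eqI)
  have sandwich: "E * X * mat_adjoint E \<in> carrier_mat N N" if "E \<in> carrier_mat N N" for E
    using that X by (rule sandwich_carrier)
  have entry: "(E * X * mat_adjoint E) $$ (a, b) = (\<Sum>e<N. \<Sum>c<N. X $$ (c, e) * (E $$ (a, c) * cnj (E $$ (b, e))))"
    if E: "E \<in> carrier_mat N N" and ab: "a < N" "b < N" for E a b
    unfolding triple_mult_index[OF E X mat_adjoint_carrier[OF E] ab]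
    using ab carrier_matD[OF E] by (intro sum.cong refl) simp
  \<comment> \<open>Applied to the matrices in \<open>B\<close> in one direction and to the indices
    in \<open>J\<close> in the other, hence for a set of arbitrary type.\<close>
  have swap: "(\<Sum>k\<in>S. \<Sum>e<N. \<Sum>c<N. X $$ (c, e) * f k c e) = (\<Sum>e<N. \<Sum>c<N. X $$ (c, e) * (\<Sum>k\<in>S. f k c e))"
    for S :: "'s set" and f :: "'s \<Rightarrow> nat \<Rightarrow> nat \<Rightarrow> complex"
  proof -
    have "(\<Sum>k\<in>S. \<Sum>e<N. \<Sum>c<N. X $$ (c, e) * f k c e) = (\<Sum>e<N. \<Sum>k\<in>S. \<Sum>c<N. X $$ (c, e) * f k c e)"
      by (rule sum.swap)
    also have "\<dots> = (\<Sum>e<N. \<Sum>c<N. \<Sum>k\<in>S. X $$ (c, e) * f k c e)"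
      by (intro sum.cong refl sum.swap)
    finally show ?thesis by (simp only: sum_distrib_left)
  qed
  show "error_map N B X \<in> carrier_mat N N"
    unfolding error_map_def using sub_frame sandwich by (intro op_sum_carrier) auto
  show "finite J" by (rule sub_frame)
  show "(1 / d) \<cdot>\<^sub>m (F i * X * mat_adjoint (F i)) \<in> carrier_mat N N" if "i \<in> J" for i
    using sandwich sub_frame(2)[OF that] by auto
  fix a b assume ab: "a < N" "b < N"
  have "error_map N B X $$ (a, b) = (\<Sum>E\<in>B. (E * X * mat_adjoint E) $$ (a, b))"
    unfolding error_map_def using sub_frame sandwich ab by (intro op_sum_index) auto
  also have "\<dots> = (\<Sum>E\<in>B. \<Sum>e<N. \<Sum>c<N. X $$ (c, e) * (E $$ (a, c) * cnj (E $$ (b, e))))"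
    using entry[OF sub_frame(4) ab] by (intro sum.cong refl) simp
  also have "\<dots> = (\<Sum>e<N. \<Sum>c<N. X $$ (c, e) * (\<Sum>E\<in>B. E $$ (a, c) * cnj (E $$ (b, e))))"
    by (rule swap)
  also have "\<dots> = (\<Sum>e<N. \<Sum>c<N. X $$ (c, e) * (\<Sum>i\<in>J. F i $$ (a, c) * cnj (F i $$ (b, e)) / d))"
    using orthonormal_basis_kernel[OF J ob ab(1) _ ab(2)]
    by (intro sum.cong refl) (simp add: sum_divide_distrib)
  also have "\<dots> = (\<Sum>i\<in>J. \<Sum>e<N. \<Sum>c<N. X $$ (c, e) * (F i $$ (a, c) * cnj (F i $$ (b, e)) / d))"
    by (rule swap[symmetric])
  also have "\<dots> = (\<Sum>i\<in>J. ((1 / d) \<cdot>\<^sub>m (F i * X * mat_adjoint (F i))) $$ (a, b))"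
  proof (intro sum.cong refl)
    fix i assume i: "i \<in> J"
    note c = sandwich[OF sub_frame(2)[OF i]]
    have "((1 / d) \<cdot>\<^sub>m (F i * X * mat_adjoint (F i))) $$ (a, b) = (F i * X * mat_adjoint (F i)) $$ (a, b) / d"
      using c ab carrier_matD[OF c] by (simp del: index_mult_mat)
    also have "\<dots> = (\<Sum>e<N. \<Sum>c<N. X $$ (c, e) * (F i $$ (a, c) * cnj (F i $$ (b, e)) / d))"
      unfolding entry[OF sub_frame(2)[OF i] ab] by (simp add: sum_divide_distrib)
    finally show "(\<Sum>e<N. \<Sum>c<N. X $$ (c, e) * (F i $$ (a, c) * cnj (F i $$ (b, e)) / d))
        = ((1 / d) \<cdot>\<^sub>m (F i * X * mat_adjoint (F i))) $$ (a, b)" by simp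
  qed
  finally show "error_map N B X $$ (a, b) = (\<Sum>i\<in>J. ((1 / d) \<cdot>\<^sub>m (F i * X * mat_adjoint (F i))) $$ (a, b))" .
qed

text \<open>The same kernel, contracted differently: both indices of the conjugated factor are
  summed against X, those of the other factor stay free.\<close>

lemma proj_map_frame:
  assumes X: "X \<in> carrier_mat N N"
  shows "proj_map N B X = op_sum N (\<lambda>i. (hs_inner (F i) X / d) \<cdot>\<^sub>m F i) J"
proof (rule op_sum_eqI)
  have swap: "(\<Sum>k\<in>S. \<Sum>e<N. \<Sum>c<N. X $$ (e, c) * f k c e) = (\<Sum>e<N. \<Sum>c<N. X $$ (e, c) * (\<Sum>k\<in>S. f k c e))"
    for S :: "'s set" and f :: "'s \<Rightarrow> nat \<Rightarrow> nat \<Rightarrow> complex"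
  proof -
    have "(\<Sum>k\<in>S. \<Sum>e<N. \<Sum>c<N. X $$ (e, c) * f k c e) = (\<Sum>e<N. \<Sum>k\<in>S. \<Sum>c<N. X $$ (e, c) * f k c e)"
      by (rule sum.swap)
    also have "\<dots> = (\<Sum>e<N. \<Sum>c<N. \<Sum>k\<in>S. X $$ (e, c) * f k c e)"
      by (intro sum.cong refl sum.swap)
    finally show ?thesis by (simp only: sum_distrib_left)
  qed
  have entry: "hs_inner E X * E $$ (a, b) = (\<Sum>e<N. \<Sum>c<N. X $$ (e, c) * (E $$ (a, b) * cnj (E $$ (e, c))))"
    if E: "E \<in> carrier_mat N N" for E a b
    unfolding hs_inner_entries[OF E X] sum_distrib_right by (intro sum.cong refl) simp
  show "proj_map N B X \<in> carrier_mat N N"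
    unfolding proj_map_def using sub_frame by (intro op_sum_carrier) auto
  show "finite J" by (rule sub_frame)
  show "(hs_inner (F i) X / d) \<cdot>\<^sub>m F i \<in> carrier_mat N N" if "i \<in> J" for i
    using sub_frame(2)[OF that] by auto
  fix a b assume ab: "a < N" "b < N"
  have "proj_map N B X $$ (a, b) = (\<Sum>E\<in>B. hs_inner E X * E $$ (a, b))"
    unfolding proj_map_def using sub_frame(3,4) ab by (intro op_sum_smult_index)
  also have "\<dots> = (\<Sum>E\<in>B. \<Sum>e<N. \<Sum>c<N. X $$ (e, c) * (E $$ (a, b) * cnj (E $$ (e, c))))"
    using entry[OF sub_frame(4)] by (intro sum.cong refl) simp
  also have "\<dots> = (\<Sum>e<N. \<Sum>c<N. X $$ (e, c) * (\<Sum>E\<in>B. E $$ (a, b) * cnj (E $$ (e, c))))"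
    by (rule swap)
  also have "\<dots> = (\<Sum>e<N. \<Sum>c<N. X $$ (e, c) * (\<Sum>i\<in>J. F i $$ (a, b) * cnj (F i $$ (e, c)) / d))"
    using orthonormal_basis_kernel[OF J ob ab]
    by (intro sum.cong refl) (simp add: sum_divide_distrib)
  also have "\<dots> = (\<Sum>i\<in>J. \<Sum>e<N. \<Sum>c<N. X $$ (e, c) * (F i $$ (a, b) * cnj (F i $$ (e, c)) / d))"
    by (rule swap[symmetric])
  also have "\<dots> = (\<Sum>i\<in>J. ((hs_inner (F i) X / d) \<cdot>\<^sub>m F i) $$ (a, b))"
  proof (intro sum.cong refl)
    fix i assume i: "i \<in> J"
    have "((hs_inner (F i) X / d) \<cdot>\<^sub>m F i) $$ (a, b) = hs_inner (F i) X * F i $$ (a, b) / d"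
      using ab carrier_matD[OF sub_frame(2)[OF i]] by simp
    also have "\<dots> = (\<Sum>e<N. \<Sum>c<N. X $$ (e, c) * (F i $$ (a, b) * cnj (F i $$ (e, c)) / d))"
      unfolding entry[OF sub_frame(2)[OF i]] by (simp add: sum_divide_distrib)
    finally show "(\<Sum>e<N. \<Sum>c<N. X $$ (e, c) * (F i $$ (a, b) * cnj (F i $$ (e, c)) / d))
        = ((hs_inner (F i) X / d) \<cdot>\<^sub>m F i) $$ (a, b)" by simp
  qed
  finally show "proj_map N B X $$ (a, b) = (\<Sum>i\<in>J. ((hs_inner (F i) X / d) \<cdot>\<^sub>m F i) $$ (a, b))" .
qed

text \<open>Conjugation by a frame member scales every \<open>F k\<close>, so the error map
  multiplies the coordinates of X by sums of these scalars. One factor \<open>1 / d\<close> comes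
  from normalising the basis, the other belongs to the coordinate of X.\<close>

lemma error_map_diagonal:
  assumes conj: "\<And>i k. i \<in> J \<Longrightarrow> k \<in> I \<Longrightarrow> F i * F k * mat_adjoint (F i) = s i k \<cdot>\<^sub>m F k"
    and X: "X \<in> carrier_mat N N"
  shows "error_map N B X = op_sum N (\<lambda>k. ((\<Sum>i\<in>J. s i k) / d * (hs_inner (F k) X / d)) \<cdot>\<^sub>m F k) I"
proof (rule op_sum_eqI)
  show "error_map N B X \<in> carrier_mat N N"
    unfolding error_map_def using sub_frame(4) X by (intro op_sum_carrier sandwich_carrier)
  show "finite I" by (rule finite_I)
  show "((\<Sum>i\<in>J. s i k) / d * (hs_inner (F k) X / d)) \<cdot>\<^sub>m F k \<in> carrier_mat N N" if "k \<in> I" for k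
    using F_carrier[OF that] by auto
  fix a b assume ab: "a < N" "b < N"
  let ?c = "\<lambda>k. hs_inner (F k) X / d"
  have Fc: "F k \<in> carrier_mat N N" "?c k \<cdot>\<^sub>m F k \<in> carrier_mat N N" if "k \<in> I" for k
    using F_carrier[OF that] by auto
  have sandwich: "F i * X * mat_adjoint (F i) = op_sum N (\<lambda>k. (?c k * s i k) \<cdot>\<^sub>m F k) I" if i: "i \<in> J" for i
  proof -
    note Fi = sub_frame(2)[OF i]
    have "F i * X * mat_adjoint (F i) = F i * op_sum N (\<lambda>k. ?c k \<cdot>\<^sub>m F k) I * mat_adjoint (F i)"
      using expansion[OF X] by simp
    also have "\<dots> = op_sum N (\<lambda>k. F i * (?c k \<cdot>\<^sub>m F k) * mat_adjoint (F i)) I"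
      using Fi mat_adjoint_carrier[OF Fi] Fc finite_I by (intro mult_op_sum_mult)
    also have "\<dots> = op_sum N (\<lambda>k. (?c k * s i k) \<cdot>\<^sub>m F k) I"
    proof (rule op_sum_cong)
      fix k assume k: "k \<in> I"
      show "F i * (?c k \<cdot>\<^sub>m F k) * mat_adjoint (F i) = (?c k * s i k) \<cdot>\<^sub>m F k"
        unfolding mult_smult_distrib[OF Fi Fc(1)[OF k]]
          mult_smult_assoc_mat[OF mult_carrier_mat[OF Fi Fc(1)[OF k]] mat_adjoint_carrier[OF Fi]]
          conj[OF i k] by (rule smult_smult_mat)
    qed (use Fc in auto)
    finally show ?thesis .
  qed
  have "error_map N B X $$ (a, b) = (\<Sum>i\<in>J. 1 / d * (F i * X * mat_adjoint (F i)) $$ (a, b))"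
    unfolding error_map_frame[OF X] using X ab
    by (intro op_sum_smult_index sub_frame(1,2) sandwich_carrier)
  also have "\<dots> = (\<Sum>i\<in>J. \<Sum>k\<in>I. s i k / d * (?c k * F k $$ (a, b)))"
    using op_sum_smult_index[OF finite_I F_carrier ab]
    by (intro sum.cong refl) (simp add: sandwich sum_distrib_left mult_ac)
  also have "\<dots> = (\<Sum>k\<in>I. \<Sum>i\<in>J. s i k / d * (?c k * F k $$ (a, b)))"
    by (rule sum.swap)
  also have "\<dots> = (\<Sum>k\<in>I. (((\<Sum>i\<in>J. s i k) / d * ?c k) \<cdot>\<^sub>m F k) $$ (a, b))"
  proof (intro sum.cong refl)
    fix k assume k: "k \<in> I"
    show "(\<Sum>i\<in>J. s i k / d * (?c k * F k $$ (a, b))) = (((\<Sum>i\<in>J. s i k) / d * ?c k) \<cdot>\<^sub>m F k) $$ (a, b)"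
      using ab carrier_matD[OF Fc(1)[OF k]]
      by (simp only: index_smult_mat sum_distrib_right[symmetric] sum_divide_distrib[symmetric] mult.assoc)
  qed
  finally show "error_map N B X $$ (a, b)
    = (\<Sum>k\<in>I. (((\<Sum>i\<in>J. s i k) / d * ?c k) \<cdot>\<^sub>m F k) $$ (a, b))" .
qed

end

text \<open>Supplies a choice of bases for the layers; without one, a condition quantified over all
  orthonormal bases would be vacuous.\<close>

lemma orthonormal_basis_normalized:
  assumes J: "J \<subseteq> I" and a: "cnj a * a * d = 1"
  shows "orthonormal_basis N (op_span N (F ` J)) ((\<lambda>E. a \<cdot>\<^sub>m E) ` F ` J)"
  unfolding orthonormal_basis_def
proof (intro conjI ballI)
  have fin: "finite (F ` J)" and FJ: "F ` J \<subseteq> carrier_mat N N"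
    using J finite_I finite_subset F_carrier by blast+
  then show "(\<lambda>E. a \<cdot>\<^sub>m E) ` F ` J \<subseteq> carrier_mat N N" by auto
  show "op_span N ((\<lambda>E. a \<cdot>\<^sub>m E) ` F ` J) = op_span N (F ` J)"
    using a by (intro op_span_scaled fin FJ) auto
  fix E E' assume "E \<in> (\<lambda>E. a \<cdot>\<^sub>m E) ` F ` J" "E' \<in> (\<lambda>E. a \<cdot>\<^sub>m E) ` F ` J"
  then obtain i j where ij: "i \<in> I" "j \<in> I" "E = a \<cdot>\<^sub>m F i" "E' = a \<cdot>\<^sub>m F j" using J by auto
  have *: "hs_inner E E' = cnj a * a * (if i = j then d else 0)"
    unfolding ij(3,4) using F_carrier[OF ij(1)] F_carrier[OF ij(2)] F_orth[OF ij(1,2)]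
    by (simp add: hs_inner_smult_left[where N = N] hs_inner_smult_right[where N = N])
  show "hs_inner E E' = (if E = E' then 1 else 0)"
  proof (cases "i = j")
    case True then show ?thesis using * a ij(3,4) by simp
  next
    case False
    then have "hs_inner E E' = 0" using * by simp
    \<comment> \<open>Distinct indices must give distinct matrices: \<open>E = E'\<close> would make
      this inner product 0.\<close>
    moreover have "hs_inner E E = 1"
      unfolding ij(3) using F_carrier[OF ij(1)] F_orth[OF ij(1,1)] a
      by (simp add: hs_inner_smult_left[where N = N] hs_inner_smult_right[where N = N] mult_ac)
    ultimately show ?thesis by auto
  qed
qed

end

section \<open>Kronecker products and the Clifford generators\<close>

lemma kron_dim [simp]:
  "dim_row (kron A B) = dim_row A * dim_row B" "dim_col (kron A B) = dim_col A * dim_col B"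
  by (simp_all add: kron_def)

lemma kron_carrier:
  assumes "A \<in> carrier_mat p q" "B \<in> carrier_mat p' q'"
  shows "kron A B \<in> carrier_mat (p * p') (q * q')"
  using carrier_matD[OF assms(1)] carrier_matD[OF assms(2)] by (intro carrier_matI) simp_all

lemma kron_index:
  "i < dim_row A * dim_row B \<Longrightarrow> j < dim_col A * dim_col B \<Longrightarrow>
    kron A B $$ (i, j) = A $$ (i div dim_row B, j div dim_col B) * B $$ (i mod dim_row B, j mod dim_col B)"
  by (simp add: kron_def)

text \<open>The mixed-product rule. The summation index on the left is a flattened pair, so the sum
  is a double sum, and it factors.\<close>

lemma kron_mult:
  assumes A: "A \<in> carrier_mat p q" and C: "C \<in> carrier_mat q s"
    and B: "B \<in> carrier_mat p' q'" and D: "D \<in> carrier_mat q' s'"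
  shows "kron A B * kron C D = kron (A * C) (B * D)"
proof (rule eq_matI)
  have dims: "dim_row A = p" "dim_col A = q" "dim_row C = q" "dim_col C = s"
    "dim_row B = p'" "dim_col B = q'" "dim_row D = q'" "dim_col D = s'"
    using assms by auto
  show "dim_row (kron A B * kron C D) = dim_row (kron (A * C) (B * D))"
    "dim_col (kron A B * kron C D) = dim_col (kron (A * C) (B * D))"
    by (simp_all add: dims)
  fix i j assume "i < dim_row (kron (A * C) (B * D))" "j < dim_col (kron (A * C) (B * D))"
  then have i: "i < p * p'" and j: "j < s * s'" by (simp_all add: dims)
  note ib = mult_index_bounds[OF i] and jb = mult_index_bounds[OF j]
  let ?f = "\<lambda>k l. (A $$ (i div p', k) * C $$ (k, j div s')) * (B $$ (i mod p', l) * D $$ (l, j mod s'))"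
  have "(kron A B * kron C D) $$ (i, j) = (\<Sum>k<q * q'. ?f (k div q') (k mod q'))"
    using i j by (simp add: dims scalar_prod_def atLeast0LessThan kron_index mult_ac)
  also have "\<dots> = (\<Sum>k<q. \<Sum>l<q'. ?f k l)" by (rule sum_product_index)
  also have "\<dots> = (\<Sum>k<q. A $$ (i div p', k) * C $$ (k, j div s')) * (\<Sum>l<q'. B $$ (i mod p', l) * D $$ (l, j mod s'))"
    by (rule sum_product[symmetric])
  also have "\<dots> = kron (A * C) (B * D) $$ (i, j)"
    using i j ib jb by (simp add: dims scalar_prod_def atLeast0LessThan kron_index)
  finally show "(kron A B * kron C D) $$ (i, j) = kron (A * C) (B * D) $$ (i, j)" .
qed

text \<open>Both sides read the same three mixed-radix digits of each index; the identities
  \<open>d\<close> say that the two orders of extracting them agree.\<close>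

lemma kron_assoc: "kron (kron A B) C = kron A (kron B C)"
proof (rule eq_matI)
  fix i j assume "i < dim_row (kron A (kron B C))" "j < dim_col (kron A (kron B C))"
  then have i: "i < dim_row A * dim_row B * dim_row C" and j: "j < dim_col A * dim_col B * dim_col C"
    by (simp_all add: mult.assoc)
  note ib = mult_index_bounds[OF i] and jb = mult_index_bounds[OF j]
  have i': "i < dim_row A * (dim_row B * dim_row C)" and j': "j < dim_col A * (dim_col B * dim_col C)"
    using i j by (simp_all add: mult.assoc)
  note ib' = mult_index_bounds[OF i'] and jb' = mult_index_bounds[OF j']
  have d: "k div (b * c) = k div c div b" "k mod (b * c) div c = k div c mod b" "k mod (b * c) mod c = k mod c"
    for k b c :: nat
  proof -
    show "k div (b * c) = k div c div b" by (metis div_mult2_eq mult.commute)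
    have m: "k mod (b * c) = c * (k div c mod b) + k mod c"
      using mod_mult2_eq[of k c b] by (simp add: mult.commute)
    show "k mod (b * c) div c = k div c mod b" unfolding m by (cases "c = 0") simp_all
    show "k mod (b * c) mod c = k mod c" unfolding m by simp
  qed
  show "kron (kron A B) C $$ (i, j) = kron A (kron B C) $$ (i, j)"
    using i j i' j' ib jb ib' jb' by (simp add: kron_index d mult.assoc)
qed (simp_all add: mult.assoc)

lemma kron_one: "kron (1\<^sub>m p) (1\<^sub>m q) = 1\<^sub>m (p * q)"
proof (rule eq_matI)
  fix i j assume "i < dim_row (1\<^sub>m (p * q) :: complex mat)" "j < dim_col (1\<^sub>m (p * q) :: complex mat)"
  then have i: "i < p * q" and j: "j < p * q" by simp_all
  note ib = mult_index_bounds[OF i] and jb = mult_index_bounds[OF j]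
  have "i = j \<longleftrightarrow> i div q = j div q \<and> i mod q = j mod q"
    by (metis div_mult_mod_eq)
  then show "kron (1\<^sub>m p) (1\<^sub>m q) $$ (i, j) = 1\<^sub>m (p * q) $$ (i, j)"
    using i j ib jb by (simp add: kron_index)
qed simp_all

lemma kron_one_1: "kron (1\<^sub>m 1) A = A"
  by (rule eq_matI) (simp_all add: kron_index)

lemma mat_adjoint_kron: "mat_adjoint (kron A B) = kron (mat_adjoint A) (mat_adjoint B)"
proof (rule eq_matI)
  fix i j assume "i < dim_row (kron (mat_adjoint A) (mat_adjoint B))"
    "j < dim_col (kron (mat_adjoint A) (mat_adjoint B))"
  then have i: "i < dim_col A * dim_col B" and j: "j < dim_row A * dim_row B" by simp_all
  note ib = mult_index_bounds[OF i] and jb = mult_index_bounds[OF j]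
  show "mat_adjoint (kron A B) $$ (i, j) = kron (mat_adjoint A) (mat_adjoint B) $$ (i, j)"
    using i j ib jb by (simp add: kron_index)
qed simp_all

lemma kron_smult_left: "kron (c \<cdot>\<^sub>m A) B = c \<cdot>\<^sub>m kron A B"
proof (rule eq_matI)
  fix i j assume "i < dim_row (c \<cdot>\<^sub>m kron A B)" "j < dim_col (c \<cdot>\<^sub>m kron A B)"
  then have i: "i < dim_row A * dim_row B" and j: "j < dim_col A * dim_col B" by simp_all
  note ib = mult_index_bounds[OF i] and jb = mult_index_bounds[OF j]
  show "kron (c \<cdot>\<^sub>m A) B $$ (i, j) = (c \<cdot>\<^sub>m kron A B) $$ (i, j)"
    using i j ib jb by (simp add: kron_index)
qed simp_all

lemma kron_smult_right: "kron A (c \<cdot>\<^sub>m B) = c \<cdot>\<^sub>m kron A B"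
proof (rule eq_matI)
  fix i j assume "i < dim_row (c \<cdot>\<^sub>m kron A B)" "j < dim_col (c \<cdot>\<^sub>m kron A B)"
  then have i: "i < dim_row A * dim_row B" and j: "j < dim_col A * dim_col B" by simp_all
  note ib = mult_index_bounds[OF i] and jb = mult_index_bounds[OF j]
  show "kron A (c \<cdot>\<^sub>m B) $$ (i, j) = (c \<cdot>\<^sub>m kron A B) $$ (i, j)"
    using i j ib jb by (simp add: kron_index)
qed simp_all

lemma mat2_cases:
  assumes "dim_row A = 2" "dim_col A = 2" "dim_row B = 2" "dim_col B = 2"
    "A $$ (0, 0) = B $$ (0, 0)" "A $$ (0, 1) = B $$ (0, 1)"
    "A $$ (1, 0) = B $$ (1, 0)" "A $$ (1, 1) = B $$ (1, 1)"
  shows "A = B"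
proof (rule eq_matI)
  fix i j assume "i < dim_row B" "j < dim_col B"
  then have "i = 0 \<or> i = 1" "j = 0 \<or> j = 1" using assms(3,4) by auto
  then show "A $$ (i, j) = B $$ (i, j)" using assms by auto
qed (use assms in auto)


section \<open>Pauli matrices and the recursion of the generators in the number of qubits\<close>

lemma pauli_dim [simp]:
  "dim_row pauli_x = 2" "dim_row pauli_y = 2" "dim_row pauli_z = 2"
  "dim_col pauli_x = 2" "dim_col pauli_y = 2" "dim_col pauli_z = 2"
  by (simp_all add: pauli_x_def pauli_y_def pauli_z_def mat_of_rows_list_def)

lemma pauli_carrier [simp]:
  "pauli_x \<in> carrier_mat 2 2" "pauli_y \<in> carrier_mat 2 2" "pauli_z \<in> carrier_mat 2 2"
  by (simp_all add: carrier_matI)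

lemma pauli_index [simp]:
  "pauli_x $$ (0, 0) = 0" "pauli_x $$ (0, Suc 0) = 1" "pauli_x $$ (Suc 0, 0) = 1" "pauli_x $$ (Suc 0, Suc 0) = 0"
  "pauli_y $$ (0, 0) = 0" "pauli_y $$ (0, Suc 0) = - \<i>" "pauli_y $$ (Suc 0, 0) = \<i>" "pauli_y $$ (Suc 0, Suc 0) = 0"
  "pauli_z $$ (0, 0) = 1" "pauli_z $$ (0, Suc 0) = 0" "pauli_z $$ (Suc 0, 0) = 0" "pauli_z $$ (Suc 0, Suc 0) = -1"
  by (simp_all add: pauli_x_def pauli_y_def pauli_z_def mat_of_rows_list_def)

lemma sum_upto_2: "(\<Sum>i = 0..<2. f i) = f 0 + f (Suc 0)" for f :: "nat \<Rightarrow> 'a::comm_monoid_add"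
  by (simp add: numeral_2_eq_2)

lemma pauli_square [simp]:
  "pauli_x * pauli_x = 1\<^sub>m 2" "pauli_y * pauli_y = 1\<^sub>m 2" "pauli_z * pauli_z = 1\<^sub>m 2"
  by (rule mat2_cases; simp add: scalar_prod_def sum_upto_2)+

lemma pauli_anticommute [simp]:
  "pauli_y * pauli_x = (-1) \<cdot>\<^sub>m (pauli_x * pauli_y)"
  "pauli_z * pauli_x = (-1) \<cdot>\<^sub>m (pauli_x * pauli_z)"
  "pauli_z * pauli_y = (-1) \<cdot>\<^sub>m (pauli_y * pauli_z)"
  by (rule mat2_cases; simp add: scalar_prod_def sum_upto_2)+

lemma pauli_adjoint [simp]:
  "mat_adjoint pauli_x = pauli_x" "mat_adjoint pauli_y = pauli_y" "mat_adjoint pauli_z = pauli_z"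
  by (rule mat2_cases; simp)+

lemma kron_pow_one: "kron_pow (1\<^sub>m 2) k = 1\<^sub>m (2 ^ k)"
  by (induction k) (simp_all add: kron_one)

lemma clifford_gen_x: "clifford_gen (Suc n) 1 = kron pauli_x (1\<^sub>m (2 ^ n))"
  by (simp add: clifford_gen_def kron_one_1[unfolded One_nat_def] kron_pow_one)

text \<open>The index is \<open>Suc n + 1\<close>, the first one of the \<open>pauli_y\<close>
  block.\<close>

lemma clifford_gen_y: "clifford_gen (Suc n) (n + 2) = kron pauli_y (1\<^sub>m (2 ^ n))"
proof -
  have "n + 2 - Suc n - 1 = 0" "2 * Suc n - (n + 2) = n" by simp_all
  then show ?thesis
    by (simp add: clifford_gen_def kron_one_1[unfolded One_nat_def] kron_pow_one)
qed

text \<open>A new qubit in front puts a \<open>pauli_z\<close> before every old generator. The two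
  new generators take the indices 1 and \<open>n + 2\<close>, so the old \<open>pauli_x\<close>
  block moves up by one and everything after it by two. The properties of the generators are proved
  by induction along this recursion.\<close>

lemma clifford_gen_Suc:
  assumes "1 \<le> k" "k \<le> 2 * n + 1"
  shows "clifford_gen (Suc n) (if k \<le> n then k + 1 else k + 2) = kron pauli_z (clifford_gen n k)"
proof -
  consider "k \<le> n" | "n < k" "k \<le> 2 * n" | "k = 2 * n + 1" using assms by linarith
  then show ?thesis
  proof cases
    case 1
    then obtain l where "k = Suc l" using assms by (cases k) auto
    with 1 show ?thesis by (simp add: clifford_gen_def kron_assoc)
  next
    case 2
    then obtain l where k: "k = n + Suc l" by (metis add_Suc_right less_iff_Suc_add)
    with 2 have "l < n" by simp
    then show ?thesis by (simp add: k clifford_gen_def kron_assoc)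
  next
    case 3
    then show ?thesis by (simp add: clifford_gen_def)
  qed
qed

lemma clifford_gen_index_cases:
  assumes "1 \<le> k" "k \<le> 2 * Suc n + 1"
  obtains "k = 1" | "k = n + 2"
  | l where "1 \<le> l" "l \<le> 2 * n + 1" "k = (if l \<le> n then l + 1 else l + 2)"
proof -
  consider "k = 1" | "k = n + 2" | "1 < k" "k < n + 2" | "n + 2 < k"
    using assms by linarith
  then show ?thesis
  proof cases
    case 3 then show ?thesis by (intro that(3)[of "k - 1"]) auto
  next
    case 4 then show ?thesis using assms by (intro that(3)[of "k - 2"]) auto
  qed (use that in auto)
qed

text \<open>Without qubits, 1 = 2 * 0 + 1 is the only index, and it carries the empty tensor power;
  this starts the inductions that follow.\<close>

lemma clifford_gen_0: "clifford_gen 0 (Suc 0) = 1\<^sub>m 1"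
  by (simp add: clifford_gen_def)

lemma clifford_gen_carrier:
  assumes "1 \<le> k" "k \<le> 2 * n + 1"
  shows "clifford_gen n k \<in> carrier_mat (2 ^ n) (2 ^ n)"
  using assms
proof (induction n arbitrary: k)
  case 0
  then have "k = Suc 0" by simp
  then show ?case by (simp add: clifford_gen_0)
next
  case (Suc n)
  from Suc.prems show ?case
  proof (cases rule: clifford_gen_index_cases)
    case 1
    have "kron pauli_x (1\<^sub>m (2 ^ n)) \<in> carrier_mat (2 * 2 ^ n) (2 * 2 ^ n)" by (intro kron_carrier) auto
    then show ?thesis unfolding 1 clifford_gen_x by simp
  next
    case 2
    have "kron pauli_y (1\<^sub>m (2 ^ n)) \<in> carrier_mat (2 * 2 ^ n) (2 * 2 ^ n)" by (intro kron_carrier) auto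
    then show ?thesis unfolding 2 clifford_gen_y by simp
  next
    case (3 l)
    have "kron pauli_z (clifford_gen n l) \<in> carrier_mat (2 * 2 ^ n) (2 * 2 ^ n)"
      using Suc.IH 3 by (intro kron_carrier) auto
    then show ?thesis unfolding 3(3) clifford_gen_Suc[OF 3(1,2)] by simp
  qed
qed

lemma clifford_gen_square:
  assumes "1 \<le> k" "k \<le> 2 * n + 1"
  shows "clifford_gen n k * clifford_gen n k = 1\<^sub>m (2 ^ n)"
  using assms
proof (induction n arbitrary: k)
  case 0
  then have "k = Suc 0" by simp
  then show ?case by (simp add: clifford_gen_0)
next
  case (Suc n)
  from Suc.prems show ?case
  proof (cases rule: clifford_gen_index_cases)
    case 1
    show ?thesis unfolding 1 clifford_gen_x
      by (subst kron_mult[where p = 2 and q = 2 and s = 2]) (auto simp: kron_one)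
  next
    case 2
    show ?thesis unfolding 2 clifford_gen_y
      by (subst kron_mult[where p = 2 and q = 2 and s = 2]) (auto simp: kron_one)
  next
    case (3 l)
    note c = clifford_gen_carrier[OF 3(1,2)]
    have "kron pauli_z (clifford_gen n l) * kron pauli_z (clifford_gen n l)
        = kron (pauli_z * pauli_z) (clifford_gen n l * clifford_gen n l)"
      by (rule kron_mult) (use c in auto)
    then show ?thesis unfolding 3(3) clifford_gen_Suc[OF 3(1,2)]
      using Suc.IH[OF 3(1,2)] by (simp add: kron_one)
  qed
qed

lemma clifford_gen_adjoint:
  assumes "1 \<le> k" "k \<le> 2 * n + 1"
  shows "mat_adjoint (clifford_gen n k) = clifford_gen n k"
  using assms
proof (induction n arbitrary: k)
  case 0
  then have "k = Suc 0" by simp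
  then show ?case by (simp add: clifford_gen_0 mat_adjoint_one[of 1, unfolded One_nat_def])
next
  case (Suc n)
  from Suc.prems show ?case
  proof (cases rule: clifford_gen_index_cases)
    case 1
    show ?thesis unfolding 1 clifford_gen_x by (simp add: mat_adjoint_kron mat_adjoint_one)
  next
    case 2
    show ?thesis unfolding 2 clifford_gen_y by (simp add: mat_adjoint_kron mat_adjoint_one)
  next
    case (3 l)
    show ?thesis unfolding 3(3) clifford_gen_Suc[OF 3(1,2)]
      using Suc.IH[OF 3(1,2)] by (simp add: mat_adjoint_kron)
  qed
qed

section \<open>Anticommutation of the generators\<close>

definition anticommuting :: "complex mat \<Rightarrow> complex mat \<Rightarrow> bool" where
  "anticommuting A B \<longleftrightarrow> A * B = (-1) \<cdot>\<^sub>m (B * A)"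

lemma anticommuting_sym: "anticommuting A B \<Longrightarrow> anticommuting B A"
  unfolding anticommuting_def by (simp add: smult_smult_mat) (intro eq_matI; simp)

lemma anticommuting_kron_left:
  assumes "anticommuting A B" "A \<in> carrier_mat p p" "B \<in> carrier_mat p p"
    "C \<in> carrier_mat q q" "D \<in> carrier_mat q q" "C * D = D * C"
  shows "anticommuting (kron A C) (kron B D)"
proof -
  have "kron A C * kron B D = kron (A * B) (C * D)" "kron B D * kron A C = kron (B * A) (D * C)"
    using assms(2-5) by (simp_all add: kron_mult)
  then show ?thesis using assms(1,6) by (simp add: anticommuting_def kron_smult_left)
qed

lemma anticommuting_kron_right:
  assumes "anticommuting C D" "A \<in> carrier_mat p p" "C \<in> carrier_mat q q" "D \<in> carrier_mat q q"
  shows "anticommuting (kron A C) (kron A D)"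
proof -
  have "kron A C * kron A D = kron (A * A) (C * D)" "kron A D * kron A C = kron (A * A) (D * C)"
    using assms(2-4) by (simp_all add: kron_mult)
  then show ?thesis using assms(1) by (simp add: anticommuting_def kron_smult_right)
qed

text \<open>If the first tensor factors differ, they anticommute, and the rest commutes because one
  of the generators continues with an identity. If they agree, both are \<open>pauli_z\<close>, and
  the induction hypothesis applies to the rest.\<close>

lemma clifford_gen_anticommuting:
  assumes "1 \<le> k" "k \<le> 2 * n + 1" "1 \<le> l" "l \<le> 2 * n + 1" "k \<noteq> l"
  shows "anticommuting (clifford_gen n k) (clifford_gen n l)"
  using assms
proof (induction n arbitrary: k l)
  case 0
  then show ?case by simp
next
  case (Suc n)
  have yx: "anticommuting (clifford_gen (Suc n) (n + 2)) (clifford_gen (Suc n) 1)"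
    unfolding clifford_gen_x clifford_gen_y
    by (rule anticommuting_kron_left) (auto simp: anticommuting_def)
  have z: "anticommuting (clifford_gen (Suc n) (if l \<le> n then l + 1 else l + 2)) (clifford_gen (Suc n) 1)"
    "anticommuting (clifford_gen (Suc n) (if l \<le> n then l + 1 else l + 2)) (clifford_gen (Suc n) (n + 2))"
    if l: "1 \<le> l" "l \<le> 2 * n + 1" for l
    unfolding clifford_gen_x clifford_gen_y clifford_gen_Suc[OF l]
    using clifford_gen_carrier[OF l]
    by (intro anticommuting_kron_left[where p = 2 and q = "2 ^ n"]; simp add: anticommuting_def)+
  from Suc.prems(1,2) show ?case
  proof (cases rule: clifford_gen_index_cases)
    case k: 1
    from Suc.prems(3,4) show ?thesis
      by (cases rule: clifford_gen_index_cases) (use k Suc.prems yx z anticommuting_sym in auto)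
  next
    case k: 2
    from Suc.prems(3,4) show ?thesis
      by (cases rule: clifford_gen_index_cases) (use k Suc.prems yx z anticommuting_sym in auto)
  next
    case k: (3 k')
    from Suc.prems(3,4) show ?thesis
    proof (cases rule: clifford_gen_index_cases)
      case 1 then show ?thesis using z(1)[OF k(1,2)] k(3) by simp
    next
      case 2 then show ?thesis using z(2)[OF k(1,2)] k(3) by simp
    next
      case (3 l')
      have "k' \<noteq> l'" using Suc.prems(5) k(3) 3(3) by auto
      then have "anticommuting (clifford_gen n k') (clifford_gen n l')"
        using Suc.IH k(1,2) 3(1,2) by blast
      then show ?thesis
        unfolding k(3) 3(3) clifford_gen_Suc[OF k(1,2)] clifford_gen_Suc[OF 3(1,2)]
        using clifford_gen_carrier[OF k(1,2)] clifford_gen_carrier[OF 3(1,2)]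
        by (intro anticommuting_kron_right[where p = 2 and q = "2 ^ n"]) auto
    qed
  qed
qed

section \<open>Monomials in the generators\<close>

lemma mult_smult_mat:
  fixes A B :: "complex mat"
  assumes "dim_row B = dim_col A"
  shows "A * (c \<cdot>\<^sub>m B) = c \<cdot>\<^sub>m (A * B)" "(c \<cdot>\<^sub>m A) * B = c \<cdot>\<^sub>m (A * B)"
proof -
  note carr = carrier_matI[OF refl refl, of A] carrier_matI[OF assms refl]
  show "A * (c \<cdot>\<^sub>m B) = c \<cdot>\<^sub>m (A * B)" by (rule mult_smult_distrib[OF carr])
  show "(c \<cdot>\<^sub>m A) * B = c \<cdot>\<^sub>m (A * B)" by (rule mult_smult_assoc_mat[OF carr])
qed

lemma clifford_word_simps [simp]:
  "clifford_word n [] = 1\<^sub>m (2 ^ n)"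
  "clifford_word n (k # ks) = clifford_gen n k * clifford_word n ks"
  by (simp_all add: clifford_word_def)

lemma clifford_word_carrier:
  assumes "set ks \<subseteq> {1..2 * n + 1}"
  shows "clifford_word n ks \<in> carrier_mat (2 ^ n) (2 ^ n)"
  using assms
proof (induction ks)
  case (Cons k ks)
  then have "clifford_gen n k \<in> carrier_mat (2 ^ n) (2 ^ n)" by (intro clifford_gen_carrier) auto
  with Cons show ?case by simp
qed simp

text \<open>Moving the generator past a letter changes the sign unless the letter is the generator
  itself; as the letters are distinct, the sign changes are counted by a set.\<close>

lemma clifford_gen_word:
  assumes k: "k \<in> {1..2 * n + 1}" and "set js \<subseteq> {1..2 * n + 1}" "distinct js"
  shows "clifford_gen n k * clifford_word n js
    = (-1) ^ card (set js - {k}) \<cdot>\<^sub>m (clifford_word n js * clifford_gen n k)"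
  using assms(2,3)
proof (induction js)
  case Nil
  have "clifford_gen n k \<in> carrier_mat (2 ^ n) (2 ^ n)" using k by (intro clifford_gen_carrier) auto
  then show ?case by (simp add: one_smult_mat)
next
  case (Cons j js)
  let ?G = "clifford_gen n k" and ?H = "clifford_gen n j" and ?W = "clifford_word n js"
  let ?c = "(-1) ^ card (set js - {k}) :: complex"
  have G: "?G \<in> carrier_mat (2 ^ n) (2 ^ n)" using k by (intro clifford_gen_carrier) auto
  have H: "?H \<in> carrier_mat (2 ^ n) (2 ^ n)" using Cons.prems by (intro clifford_gen_carrier) auto
  have W: "?W \<in> carrier_mat (2 ^ n) (2 ^ n)" using Cons.prems by (intro clifford_word_carrier) auto
  note dims = carrier_matD[OF G] carrier_matD[OF H] carrier_matD[OF W]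
  have IH: "?G * ?W = ?c \<cdot>\<^sub>m (?W * ?G)" using Cons by simp
  have *: "?G * (?H * ?W) = (if j = k then ?c else - ?c) \<cdot>\<^sub>m (?H * ?W * ?G)"
  proof (cases "j = k")
    case True
    have "?G * (?G * ?W) = ?c \<cdot>\<^sub>m (?G * (?W * ?G))"
      unfolding IH by (simp add: mult_smult_mat dims)
    also have "?G * (?W * ?G) = ?G * ?W * ?G" using assoc_mult_mat[OF G W G] by simp
    finally show ?thesis using True by simp
  next
    case False
    have "?G * ?H = (-1) \<cdot>\<^sub>m (?H * ?G)"
      using clifford_gen_anticommuting[of k n j] k Cons.prems False by (auto simp: anticommuting_def)
    then have "?G * (?H * ?W) = ((-1) \<cdot>\<^sub>m (?H * ?G)) * ?W"
      using assoc_mult_mat[OF G H W] by simp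
    also have "\<dots> = (-1) \<cdot>\<^sub>m (?H * (?G * ?W))"
      using assoc_mult_mat[OF H G W] by (simp add: mult_smult_mat dims)
    also have "\<dots> = (- ?c) \<cdot>\<^sub>m (?H * (?W * ?G))"
      unfolding IH by (simp add: mult_smult_mat dims smult_smult_mat)
    also have "?H * (?W * ?G) = ?H * ?W * ?G" using assoc_mult_mat[OF H W G] by simp
    finally show ?thesis using False by simp
  qed
  have "(-1) ^ card (set (j # js) - {k}) = (if j = k then ?c else - ?c)"
    using Cons.prems(2) by (auto simp: insert_Diff_if)
  with * show ?case by simp
qed

lemma clifford_word_word:
  assumes "set ks \<subseteq> {1..2 * n + 1}" "distinct ks" and js: "set js \<subseteq> {1..2 * n + 1}" "distinct js"
  shows "clifford_word n ks * clifford_word n js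
    = (-1) ^ (\<Sum>k\<in>set ks. card (set js - {k})) \<cdot>\<^sub>m (clifford_word n js * clifford_word n ks)"
  using assms(1,2)
proof (induction ks)
  case Nil
  then show ?case using clifford_word_carrier[OF js(1)] by (simp add: one_smult_mat)
next
  case (Cons k ks)
  let ?G = "clifford_gen n k" and ?V = "clifford_word n ks" and ?W = "clifford_word n js"
  let ?c = "(-1) ^ card (set js - {k}) :: complex"
  let ?s = "(-1) ^ (\<Sum>k\<in>set ks. card (set js - {k})) :: complex"
  have G: "?G \<in> carrier_mat (2 ^ n) (2 ^ n)" using Cons.prems by (intro clifford_gen_carrier) auto
  have V: "?V \<in> carrier_mat (2 ^ n) (2 ^ n)" using Cons.prems by (intro clifford_word_carrier) auto
  have W: "?W \<in> carrier_mat (2 ^ n) (2 ^ n)" using js by (intro clifford_word_carrier) auto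
  note dims = carrier_matD[OF G] carrier_matD[OF V] carrier_matD[OF W]
  have IH: "?V * ?W = ?s \<cdot>\<^sub>m (?W * ?V)" using Cons by simp
  have GW: "?G * ?W = ?c \<cdot>\<^sub>m (?W * ?G)" using clifford_gen_word[of k n js] js Cons.prems by simp
  have "?G * ?V * ?W = ?G * (?V * ?W)" using assoc_mult_mat[OF G V W] .
  also have "\<dots> = ?s \<cdot>\<^sub>m (?G * ?W * ?V)"
    unfolding IH using assoc_mult_mat[OF G W V] by (simp add: mult_smult_mat dims)
  also have "\<dots> = (?c * ?s) \<cdot>\<^sub>m (?W * (?G * ?V))"
    unfolding GW using assoc_mult_mat[OF W G V]
    by (simp add: mult_smult_mat dims smult_smult_mat mult.commute)
  also have "?c * ?s = (-1) ^ (\<Sum>k\<in>set (k # ks). card (set js - {k}))"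
    using Cons.prems(2) by (simp add: power_add)
  finally show ?case by simp
qed

lemma clifford_word_unitary:
  assumes "set ks \<subseteq> {1..2 * n + 1}"
  shows "clifford_word n ks * mat_adjoint (clifford_word n ks) = 1\<^sub>m (2 ^ n)"
  using assms
proof (induction ks)
  case Nil
  then show ?case by (simp add: mat_adjoint_one)
next
  case (Cons k ks)
  let ?G = "clifford_gen n k" and ?V = "clifford_word n ks"
  have G: "?G \<in> carrier_mat (2 ^ n) (2 ^ n)" using Cons.prems by (intro clifford_gen_carrier) auto
  have V: "?V \<in> carrier_mat (2 ^ n) (2 ^ n)" using Cons.prems by (intro clifford_word_carrier) auto
  note Va = mat_adjoint_carrier[OF V]
  have adj: "mat_adjoint (?G * ?V) = mat_adjoint ?V * ?G"
    using mat_adjoint_mult[OF G V] clifford_gen_adjoint[of k n] Cons.prems by simp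
  have "?G * ?V * (mat_adjoint ?V * ?G) = ?G * (?V * (mat_adjoint ?V * ?G))"
    by (rule assoc_mult_mat[OF G V mult_carrier_mat[OF Va G]])
  also have "?V * (mat_adjoint ?V * ?G) = ?G"
    using assoc_mult_mat[OF V Va G] Cons G by simp
  also have "?G * ?G = 1\<^sub>m (2 ^ n)" using Cons.prems by (intro clifford_gen_square) auto
  finally show ?case using adj by simp
qed

text \<open>The adjoint reverses a product of Hermitian generators, and restoring the order costs
  only signs. Knowing the adjoint up to sign is enough to find a self-adjoint multiple.\<close>

lemma clifford_word_adjoint:
  assumes "set ks \<subseteq> {1..2 * n + 1}" "distinct ks"
  shows "mat_adjoint (clifford_word n ks) = clifford_word n ks \<or>
    mat_adjoint (clifford_word n ks) = (-1) \<cdot>\<^sub>m clifford_word n ks"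
  using assms
proof (induction ks)
  case Nil
  then show ?case by (simp add: mat_adjoint_one)
next
  case (Cons k ks)
  let ?G = "clifford_gen n k" and ?V = "clifford_word n ks"
  have G: "?G \<in> carrier_mat (2 ^ n) (2 ^ n)" using Cons.prems by (intro clifford_gen_carrier) auto
  have V: "?V \<in> carrier_mat (2 ^ n) (2 ^ n)" using Cons.prems by (intro clifford_word_carrier) auto
  note dims = carrier_matD[OF G] carrier_matD[OF V]
  let ?c = "(-1) ^ card (set ks - {k}) :: complex"
  have adj: "mat_adjoint (?G * ?V) = mat_adjoint ?V * ?G"
    using mat_adjoint_mult[OF G V] clifford_gen_adjoint[of k n] Cons.prems by simp
  \<comment> \<open>The reordering is read backwards, using that the sign squares to 1.\<close>
  have "?G * ?V = ?c \<cdot>\<^sub>m (?V * ?G)" using clifford_gen_word[of k n ks] Cons.prems by simp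
  then have "?c \<cdot>\<^sub>m (?G * ?V) = (?c * ?c) \<cdot>\<^sub>m (?V * ?G)" by (simp add: smult_smult_mat)
  also have "?c * ?c = 1" by (simp flip: power_add add: mult_2[symmetric])
  finally have VG: "?V * ?G = ?c \<cdot>\<^sub>m (?G * ?V)" by (simp add: one_smult_mat)
  have IH: "mat_adjoint ?V = ?V \<or> mat_adjoint ?V = (-1) \<cdot>\<^sub>m ?V" using Cons by simp
  have "?c = 1 \<or> ?c = -1" by (simp add: minus_one_power_iff)
  with IH show ?case
    by (auto simp: adj VG mult_smult_mat dims smult_smult_mat one_smult_mat)
qed

text \<open>Indexed by sets instead of words, because layers and signs depend only on cardinalities
  and intersections.\<close>

definition clifford_monomial :: "nat \<Rightarrow> nat set \<Rightarrow> complex mat" where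
  "clifford_monomial n K = clifford_word n (sorted_list_of_set K)"

context
  fixes n :: nat and K :: "nat set"
  assumes K: "K \<subseteq> {1..2 * n + 1}"
begin

lemma sorted_list_of_set_index: "set (sorted_list_of_set K) = K" "set (sorted_list_of_set K) \<subseteq> {1..2 * n + 1}"
  using K finite_subset[OF K] by auto

lemma clifford_monomial_carrier: "clifford_monomial n K \<in> carrier_mat (2 ^ n) (2 ^ n)"
  unfolding clifford_monomial_def using sorted_list_of_set_index by (intro clifford_word_carrier) auto

lemma clifford_monomial_unitary:
  "clifford_monomial n K * mat_adjoint (clifford_monomial n K) = 1\<^sub>m (2 ^ n)"
  "mat_adjoint (clifford_monomial n K) * clifford_monomial n K = 1\<^sub>m (2 ^ n)"
proof -
  show *: "clifford_monomial n K * mat_adjoint (clifford_monomial n K) = 1\<^sub>m (2 ^ n)"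
    unfolding clifford_monomial_def using sorted_list_of_set_index by (intro clifford_word_unitary) auto
  show "mat_adjoint (clifford_monomial n K) * clifford_monomial n K = 1\<^sub>m (2 ^ n)"
    by (rule mat_mult_left_right_inverse[OF _ _ *]) (use clifford_monomial_carrier in auto)
qed

lemma clifford_monomial_adjoint:
  "mat_adjoint (clifford_monomial n K) = clifford_monomial n K \<or>
   mat_adjoint (clifford_monomial n K) = (-1) \<cdot>\<^sub>m clifford_monomial n K"
  unfolding clifford_monomial_def using sorted_list_of_set_index
  by (intro clifford_word_adjoint) auto

lemma clifford_gen_monomial:
  "k \<in> {1..2 * n + 1} \<Longrightarrow> clifford_gen n k * clifford_monomial n K
    = (-1) ^ card (K - {k}) \<cdot>\<^sub>m (clifford_monomial n K * clifford_gen n k)"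
  unfolding clifford_monomial_def using clifford_gen_word[of k n "sorted_list_of_set K"] sorted_list_of_set_index
  by auto

end

text \<open>Each summand is \<open>card J\<close>, lowered by one exactly when k lies in J. The
  additive form avoids truncated subtraction.\<close>

lemma sum_card_Diff_singleton:
  assumes "finite K" "finite J"
  shows "(\<Sum>k\<in>K. card (J - {k})) + card (K \<inter> J) = card K * card J"
proof -
  have "(\<Sum>k\<in>K. card (J - {k})) + card (K \<inter> J) = (\<Sum>k\<in>K. card (J - {k}) + (if k \<in> J then 1 else 0))"
    using assms by (simp add: sum.distrib sum.If_cases Int_def)
  also have "\<dots> = (\<Sum>k\<in>K. card J)"
    using assms by (intro sum.cong refl) (auto simp: card.remove[of J] simp del: card_Diff_insert)
  finally show ?thesis by simp
qed

text \<open>Interchanging the two monomials produces the sign; then the monomial of K meets its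
  adjoint and cancels.\<close>

lemma clifford_monomial_conjugate:
  assumes K: "K \<subseteq> {1..2 * n + 1}" and J: "J \<subseteq> {1..2 * n + 1}"
  shows "clifford_monomial n K * clifford_monomial n J * mat_adjoint (clifford_monomial n K)
    = (-1) ^ (card K * card J + card (K \<inter> J)) \<cdot>\<^sub>m clifford_monomial n J"
proof -
  let ?U = "clifford_monomial n K" and ?V = "clifford_monomial n J"
  let ?e = "\<Sum>k\<in>K. card (J - {k})"
  note Uc = clifford_monomial_carrier[OF K] and Vc = clifford_monomial_carrier[OF J]
  note Ua = mat_adjoint_carrier[OF Uc]
  note dims = carrier_matD[OF Uc] carrier_matD[OF Vc]
  have "?U * ?V = (-1) ^ ?e \<cdot>\<^sub>m (?V * ?U)"
    unfolding clifford_monomial_def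
    using clifford_word_word[of "sorted_list_of_set K" n "sorted_list_of_set J"]
      sorted_list_of_set_index[OF K] sorted_list_of_set_index[OF J] by simp
  then have "?U * ?V * mat_adjoint ?U = (-1) ^ ?e \<cdot>\<^sub>m (?V * (?U * mat_adjoint ?U))"
    using assoc_mult_mat[OF Vc Uc Ua] by (simp add: mult_smult_mat dims)
  also have "\<dots> = (-1) ^ ?e \<cdot>\<^sub>m ?V"
    unfolding clifford_monomial_unitary[OF K] using Vc by simp
  \<comment> \<open>The exponent is really a difference of the two terms; their sum has the same
    parity and involves no truncated subtraction.\<close>
  also have "(-1) ^ ?e = ((-1) ^ (card K * card J + card (K \<inter> J)) :: complex)"
  proof -
    have "card K * card J = ?e + card (K \<inter> J)"
      using sum_card_Diff_singleton[OF finite_subset[OF K] finite_subset[OF J]] by simp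
    then have "even (card K * card J + card (K \<inter> J)) = even ?e" by simp blast
    then show ?thesis by (simp add: minus_one_power_iff)
  qed
  finally show ?thesis .
qed

lemma clifford_monomial_norm:
  assumes "K \<subseteq> {1..2 * n + 1}"
  shows "hs_inner (clifford_monomial n K) (clifford_monomial n K) = 2 ^ n"
  unfolding hs_inner_def clifford_monomial_unitary[OF assms] by (simp add: mat_trace_def)

text \<open>
  Conjugation by the generator \<open>k\<close> preserves the inner product, but acts on the two
  monomials by opposite signs.
\<close>
lemma clifford_monomial_orthogonal:
  assumes K: "K \<subseteq> {1..2 * n + 1}" and L: "L \<subseteq> {1..2 * n + 1}"
    and k: "k \<in> {1..2 * n + 1}" and odd: "odd (card (K - {k}) + card (L - {k}))"
  shows "hs_inner (clifford_monomial n K) (clifford_monomial n L) = 0"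
proof -
  let ?U = "clifford_monomial n K" and ?V = "clifford_monomial n L" and ?G = "clifford_gen n k"
  let ?c = "(-1) ^ card (K - {k}) :: complex" and ?d = "(-1) ^ card (L - {k}) :: complex"
  note Uc = clifford_monomial_carrier[OF K] and Vc = clifford_monomial_carrier[OF L]
  note Ua = mat_adjoint_carrier[OF Uc]
  have G: "?G \<in> carrier_mat (2 ^ n) (2 ^ n)" using k by (intro clifford_gen_carrier) auto
  have Gadj: "mat_adjoint ?G = ?G" using k by (intro clifford_gen_adjoint) auto
  have GG: "?G * ?G = 1\<^sub>m (2 ^ n)" using k by (intro clifford_gen_square) auto
  note dims = carrier_matD[OF Uc] carrier_matD[OF Vc] carrier_matD[OF G]
  have GV: "?G * ?V = ?d \<cdot>\<^sub>m (?V * ?G)" by (rule clifford_gen_monomial[OF L k])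
  have "mat_adjoint (?G * ?U) = ?c \<cdot>\<^sub>m mat_adjoint (?U * ?G)"
    unfolding clifford_gen_monomial[OF K k] mat_adjoint_smult by simp
  then have UG: "mat_adjoint ?U * ?G = ?c \<cdot>\<^sub>m (?G * mat_adjoint ?U)"
    unfolding mat_adjoint_mult[OF G Uc] mat_adjoint_mult[OF Uc G] Gadj .
  have UG_c: "mat_adjoint ?U * ?G \<in> carrier_mat (2 ^ n) (2 ^ n)"
    and VG_c: "?V * ?G \<in> carrier_mat (2 ^ n) (2 ^ n)" using Ua Vc G by auto
  have "mat_adjoint ?U * ?V = mat_adjoint ?U * ?G * (?G * ?V)"
    unfolding assoc_mult_mat[OF Ua G mult_carrier_mat[OF G Vc]] assoc_mult_mat[OF G G Vc, symmetric] GG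
      left_mult_one_mat[OF Vc] ..
  also have "\<dots> = ?d \<cdot>\<^sub>m (mat_adjoint ?U * ?G * (?V * ?G))"
    unfolding GV by (simp add: mult_smult_mat dims)
  also have "\<dots> = (?d * ?c) \<cdot>\<^sub>m (?G * mat_adjoint ?U * (?V * ?G))"
    unfolding UG by (simp add: mult_smult_mat dims smult_smult_mat)
  also have "?d * ?c = -1" using odd by (simp flip: power_add add: minus_one_power_iff add.commute)
  finally have "hs_inner ?U ?V = mat_trace ((-1) \<cdot>\<^sub>m (?G * mat_adjoint ?U * (?V * ?G)))"
    by (simp add: hs_inner_def)
  also have "\<dots> = - mat_trace (?G * mat_adjoint ?U * (?V * ?G))"
    by (simp add: mat_trace_def dims sum_negf)
  also have "mat_trace (?G * mat_adjoint ?U * (?V * ?G)) = mat_trace (?V * ?G * (?G * mat_adjoint ?U))"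
    by (rule mat_trace_comm[OF mult_carrier_mat[OF G Ua] VG_c])
  also have "?V * ?G * (?G * mat_adjoint ?U) = ?V * mat_adjoint ?U"
    unfolding assoc_mult_mat[OF Vc G mult_carrier_mat[OF G Ua]] assoc_mult_mat[OF G G Ua, symmetric] GG
      left_mult_one_mat[OF Ua] ..
  also have "mat_trace (?V * mat_adjoint ?U) = hs_inner ?U ?V"
    unfolding hs_inner_def by (rule mat_trace_comm[OF Vc Ua])
  finally show ?thesis by simp
qed

section \<open>The layers and their coefficients\<close>

text \<open>A set K amounts to independent choices of its parts inside and outside J. Grouping by
  the size s of the inner part gives a product of two binomial coefficients.\<close>

lemma sum_subsets_card_Int:
  fixes f :: "nat \<Rightarrow> 'a::comm_semiring_1"
  assumes A: "finite A" and J: "J \<subseteq> A"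
  shows "(\<Sum>K | K \<subseteq> A \<and> card K = t. f (card (K \<inter> J)))
    = (\<Sum>s=0..t. f s * of_nat (card J choose s) * of_nat ((card A - card J) choose (t - s)))"
proof -
  have finJ: "finite J" using A J finite_subset by blast
  let ?S = "{K. K \<subseteq> A \<and> card K = t}"
  have "(\<Sum>K\<in>?S. f (card (K \<inter> J))) = (\<Sum>s=0..t. \<Sum>K | K \<in> ?S \<and> card (K \<inter> J) = s. f (card (K \<inter> J)))"
  proof (rule sum.group[symmetric])
    show "(\<lambda>K. card (K \<inter> J)) ` ?S \<subseteq> {0..t}"
      using A finite_subset by (fastforce intro!: card_mono)
  qed (use A in auto)
  also have "\<dots> = (\<Sum>s=0..t. f s * of_nat (card J choose s) * of_nat ((card A - card J) choose (t - s)))"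
  proof (rule sum.cong[OF refl])
    fix s assume s: "s \<in> {0..t}"
    let ?P = "{P. P \<subseteq> J \<and> card P = s}" and ?Q = "{Q. Q \<subseteq> A - J \<and> card Q = t - s}"
    have "bij_betw (\<lambda>(P, Q). P \<union> Q) (?P \<times> ?Q) {K. K \<in> ?S \<and> card (K \<inter> J) = s}"
    proof (rule bij_betw_byWitness[where f' = "\<lambda>K. (K \<inter> J, K - J)"])
      show "(\<lambda>(P, Q). P \<union> Q) ` (?P \<times> ?Q) \<subseteq> {K. K \<in> ?S \<and> card (K \<inter> J) = s}"
      proof (rule image_subsetI)
        fix z assume "z \<in> ?P \<times> ?Q"
        then obtain P Q where z: "z = (P, Q)" and PQ: "P \<subseteq> J" "card P = s" "Q \<subseteq> A - J" "card Q = t - s"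
          by auto
        have "finite P" "finite Q" using PQ A finJ by (auto intro: finite_subset)
        moreover have "P \<inter> Q = {}" using PQ by auto
        \<comment> \<open>The range of s matters here: \<open>s + (t - s) = t\<close> needs
          \<open>s \<le> t\<close>.\<close>
        ultimately have "card (P \<union> Q) = t" using PQ s by (simp add: card_Un_disjoint)
        moreover have "(P \<union> Q) \<inter> J = P" "P \<union> Q \<subseteq> A" using PQ J by auto
        ultimately show "(case z of (P, Q) \<Rightarrow> P \<union> Q) \<in> {K. K \<in> ?S \<and> card (K \<inter> J) = s}"
          using z PQ by simp
      qed
      show "(\<lambda>K. (K \<inter> J, K - J)) ` {K. K \<in> ?S \<and> card (K \<inter> J) = s} \<subseteq> ?P \<times> ?Q"
      proof (rule image_subsetI)
        fix K assume "K \<in> {K. K \<in> ?S \<and> card (K \<inter> J) = s}"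
        then have K: "K \<subseteq> A" "card (K \<inter> J) = s" "card K = t" by auto
        have "finite K" using K(1) A finite_subset by blast
        then have "card (K - J) = t - s" using K by (simp add: card_Diff_subset_Int)
        then show "(K \<inter> J, K - J) \<in> ?P \<times> ?Q" using K by auto
      qed
    qed auto
    then have "card {K. K \<in> ?S \<and> card (K \<inter> J) = s} = card (?P \<times> ?Q)"
      by (rule bij_betw_same_card[symmetric])
    also have "\<dots> = (card J choose s) * ((card A - card J) choose (t - s))"
      using A J finJ by (simp add: card_cartesian_product n_subsets card_Diff_subset)
    finally have "card {K. K \<in> ?S \<and> card (K \<inter> J) = s} = (card J choose s) * ((card A - card J) choose (t - s))" .
    moreover have "(\<Sum>K | K \<in> ?S \<and> card (K \<inter> J) = s. f (card (K \<inter> J))) = (\<Sum>K | K \<in> ?S \<and> card (K \<inter> J) = s. f s)"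
      by (intro sum.cong) auto
    ultimately show "(\<Sum>K | K \<in> ?S \<and> card (K \<inter> J) = s. f (card (K \<inter> J)))
        = f s * of_nat (card J choose s) * of_nat ((card A - card J) choose (t - s))"
      by (simp add: mult_ac)
  qed
  finally show ?thesis .
qed

text \<open>A set and its complement have 2n + 1 elements together, so exactly one of them has at
  most n; half of all subsets are counted.\<close>

lemma card_small_subsets_odd:
  "card {K. K \<subseteq> {1..2 * n + 1} \<and> card K \<le> n} = 2 ^ (2 * n)"
proof -
  let ?A = "{1..2 * n + 1}" and ?S = "{K. K \<subseteq> {1..2 * n + 1} \<and> card K \<le> n}"
  have card_compl: "card (?A - K) = 2 * n + 1 - card K" if "K \<subseteq> ?A" for K
    using that card_Diff_subset[of K ?A] finite_subset[OF that] by simp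
  have fin: "finite ?S" by (rule finite_subset[of _ "Pow ?A"]) auto
  have "Pow ?A \<subseteq> ?S \<union> (\<lambda>K. ?A - K) ` ?S"
  proof
    fix K assume "K \<in> Pow ?A"
    then have K: "K \<subseteq> ?A" by simp
    show "K \<in> ?S \<union> (\<lambda>K. ?A - K) ` ?S"
    proof (cases "card K \<le> n")
      case False
      then have "?A - K \<in> ?S" using card_compl[OF K] by auto
      moreover have "K = ?A - (?A - K)" using K by auto
      ultimately show ?thesis by blast
    qed (use K in simp)
  qed
  then have "Pow ?A = ?S \<union> (\<lambda>K. ?A - K) ` ?S" by auto
  moreover have "?S \<inter> (\<lambda>K. ?A - K) ` ?S = {}"
    using card_compl by fastforce
  moreover have "inj_on (\<lambda>K. ?A - K) ?S" by (rule inj_onI) auto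
  ultimately have "card (Pow ?A) = card ?S + card ?S"
    using fin by (simp add: card_Un_disjoint card_image)
  then show ?thesis by (simp add: card_Pow)
qed

text \<open>Strictly increasing words correspond to their sets of letters, length becoming
  cardinality. The radius is an arbitrary real, as the minimality of the diameter requires.\<close>

lemma clifford_metric_monomials:
  "clifford_metric n m t
    = op_span (2 ^ n) (clifford_monomial n ` {K. K \<subseteq> {1..m} \<and> int (card K) \<le> \<lfloor>t\<rfloor>})"
proof -
  have "{clifford_word n ks | ks. sorted_wrt (<) ks \<and> set ks \<subseteq> {1..m} \<and> int (length ks) \<le> \<lfloor>t\<rfloor>}
    = clifford_monomial n ` {K. K \<subseteq> {1..m} \<and> int (card K) \<le> \<lfloor>t\<rfloor>}" (is "?L = ?R")
  proof
    show "?L \<subseteq> ?R"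
    proof clarify
      fix ks assume ks: "sorted_wrt (<) ks" "set ks \<subseteq> {1..m}" "int (length ks) \<le> \<lfloor>t\<rfloor>"
      have sd: "sorted ks" "distinct ks" using ks(1) by (auto simp: strict_sorted_iff)
      have "clifford_word n ks = clifford_monomial n (set ks)"
        unfolding clifford_monomial_def sorted_list_of_set.idem_if_sorted_distinct[OF sd] ..
      moreover have "card (set ks) = length ks" by (rule distinct_card[OF sd(2)])
      ultimately show "clifford_word n ks \<in> ?R" using ks by auto
    qed
    show "?R \<subseteq> ?L"
    proof clarify
      fix K assume K: "K \<subseteq> {1..m}" "int (card K) \<le> \<lfloor>t\<rfloor>"
      have "finite K" using K(1) finite_subset by blast
      then show "\<exists>ks. clifford_monomial n K = clifford_word n ks \<and> sorted_wrt (<) ks \<and> set ks \<subseteq> {1..m} \<and> int (length ks) \<le> \<lfloor>t\<rfloor>"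
        using K by (intro exI[of _ "sorted_list_of_set K"]) (simp add: clifford_monomial_def)
    qed
  qed
  then show ?thesis unfolding clifford_metric_def by simp
qed

text \<open>Both values of m are treated together; they differ in substance only in
  \<open>card_indices\<close> and \<open>separating_generator\<close>.\<close>

locale clifford_parameters =
  fixes n m r :: nat
  assumes m_r: "m = 2 * n \<and> r = 2 * n \<or> m = 2 * n + 1 \<and> r = n"
begin

definition indices :: "nat set set" where
  "indices = {K. K \<subseteq> {1..m} \<and> card K \<le> r}"

definition level :: "nat \<Rightarrow> nat set set" where
  "level j = {K \<in> indices. card K = j}"

text \<open>The sum is the binary Krawtchouk polynomial of degree t and length m, evaluated at
  j.\<close>

definition clifford_W :: "nat \<Rightarrow> nat \<Rightarrow> real" where
  "clifford_W t j = (-1) ^ (t * j) / 2 ^ n *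
    (\<Sum>s=0..t. (-1) ^ s * real (j choose s) * real ((m - j) choose (t - s)))"

lemma r_le_m: "r \<le> m" using m_r by auto

lemma indices_subset: "K \<in> indices \<Longrightarrow> K \<subseteq> {1..2 * n + 1}"
  using m_r by (auto simp: indices_def)

lemma finite_indices: "finite indices"
  by (rule finite_subset[of _ "Pow {1..m}"]) (auto simp: indices_def)

lemma card_indices: "card indices = 2 ^ n * 2 ^ n"
proof -
  have "card indices = 2 ^ (2 * n)"
  proof (cases "m = 2 * n")
    case True
    then have "r = 2 * n" using m_r by auto
    have "card K \<le> 2 * n" if "K \<subseteq> {1..2 * n}" for K using card_mono[OF _ that] by simp
    then have "(K \<subseteq> {1..2 * n} \<and> card K \<le> 2 * n) = (K \<subseteq> {1..2 * n})" for K by metis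
    then have "{K. K \<subseteq> {1..m} \<and> card K \<le> r} = Pow {1..2 * n}"
      unfolding True \<open>r = 2 * n\<close> Pow_def by (rule Collect_cong)
    then have "indices = Pow {1..2 * n}" unfolding indices_def .
    then show ?thesis by (simp add: card_Pow)
  next
    case False
    then have "m = 2 * n + 1" "r = n" using m_r by auto
    then have "card {K. K \<subseteq> {1..m} \<and> card K \<le> r} = 2 ^ (2 * n)"
      using card_small_subsets_odd[of n] by simp
    then show ?thesis unfolding indices_def .
  qed
  then show ?thesis by (simp flip: power_add add: mult_2)
qed

text \<open>
  Two distinct index sets never cover all \<open>2n + 1\<close> generators, so when their cardinalities
  have different parity they are separated by a generator outside both, and otherwise by
  one in their symmetric difference.
\<close>
lemma separating_generator:
  assumes K: "K \<in> indices" and L: "L \<in> indices" and "K \<noteq> L"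
  obtains k where "k \<in> {1..2 * n + 1}" "odd (card (K - {k}) + card (L - {k}))"
proof (cases "even (card K + card L)")
  case True
  obtain k where k: "k \<in> K \<and> k \<notin> L \<or> k \<in> L \<and> k \<notin> K" using assms by blast
  have fin: "finite K" "finite L" using K L indices_subset finite_subset by blast+
  have "k \<in> {1..2 * n + 1}" using k indices_subset K L by blast
  moreover have "card K + card L = Suc (card (K - {k}) + card (L - {k}))"
    using k card.remove[OF fin(1), of k] card.remove[OF fin(2), of k] by auto
  then have "odd (card (K - {k}) + card (L - {k}))" using True by simp
  ultimately show ?thesis using that by blast
next
  case False
  have "card (K \<union> L) \<le> 2 * n"
  proof (cases "m = 2 * n")
    case True
    have "K \<union> L \<subseteq> {1..m}" using K L unfolding indices_def by blast
    then have "K \<union> L \<subseteq> {1..2 * n}" unfolding True .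
    from card_mono[OF _ this] show ?thesis by simp
  next
    case False
    then have "r = n" using m_r by simp
    moreover have "card K \<le> r" "card L \<le> r" using K L unfolding indices_def by blast+
    ultimately show ?thesis using card_Un_le[of K L] by linarith
  qed
  then have "{1..2 * n + 1} \<noteq> K \<union> L" using card_atLeastAtMost[of 1 "2 * n + 1"] by (intro notI) (simp del: card_atLeastAtMost)
  then obtain k where k: "k \<in> {1..2 * n + 1}" "k \<notin> K" "k \<notin> L"
    using indices_subset[OF K] indices_subset[OF L] by blast
  then show ?thesis using that False by auto
qed

text \<open>The constant \<open>d\<close> is the trace of the identity: it equals the dimension of
  the Hilbert space because the monomials are unitary.\<close>

sublocale orthogonal_frame "2 ^ n" "2 ^ n" indices "clifford_monomial n"
proof
  fix K L assume KL: "K \<in> indices" "L \<in> indices"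
  show "hs_inner (clifford_monomial n K) (clifford_monomial n L) = (if K = L then 2 ^ n else 0)"
  proof (cases "K = L")
    case True
    then show ?thesis using clifford_monomial_norm indices_subset KL by simp
  next
    case False
    then obtain k where "k \<in> {1..2 * n + 1}" "odd (card (K - {k}) + card (L - {k}))"
      using separating_generator KL by blast
    then show ?thesis
      using False clifford_monomial_orthogonal indices_subset KL by simp
  qed
qed (use finite_indices card_indices clifford_monomial_carrier[OF indices_subset] in simp_all)

section \<open>The metric, its diameter and its layers in coordinates\<close>

lemma exists_index:
  assumes "j \<le> r"
  obtains K where "K \<in> indices" "card K = j"
  using that[of "{1..j}"] assms r_le_m by (auto simp: indices_def)

lemma metric_eq:
  assumes "j \<le> r"
  shows "clifford_metric n m (real j) = op_span (2 ^ n) (clifford_monomial n ` {K \<in> indices. card K \<le> j})"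
proof -
  \<comment> \<open>Here \<open>j \<le> r\<close> makes the cut-off of \<open>indices\<close> at r
    automatic.\<close>
  have "{K. K \<subseteq> {1..m} \<and> int (card K) \<le> \<lfloor>real j\<rfloor>} = {K \<in> indices. card K \<le> j}"
    using assms by (auto simp: indices_def)
  then show ?thesis by (simp add: clifford_metric_monomials)
qed

text \<open>At radius r the whole frame is available. Below it every monomial with r letters is
  missing, and such a monomial, being nonzero and orthogonal to the available ones, lies outside
  their span.\<close>

lemma diameter: "qm_diameter (2 ^ n) (clifford_metric n m) = real r"
  unfolding qm_diameter_def
proof (rule Least_equality)
  have "{K \<in> indices. card K \<le> r} = indices" by (auto simp: indices_def)
  then show "0 \<le> real r \<and> clifford_metric n m (real r) = carrier_mat (2 ^ n) (2 ^ n)"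
    using metric_eq[of r] span_I by simp
next
  fix t :: real assume t: "0 \<le> t \<and> clifford_metric n m t = carrier_mat (2 ^ n) (2 ^ n)"
  show "real r \<le> t"
  proof (rule ccontr)
    assume "\<not> real r \<le> t"
    then have fl: "\<lfloor>t\<rfloor> < int r" by (simp add: floor_less_iff)
    let ?J = "{K. K \<subseteq> {1..m} \<and> int (card K) \<le> \<lfloor>t\<rfloor>}"
    have J: "?J \<subseteq> indices" using fl by (auto simp: indices_def)
    obtain K where K: "K \<in> indices" "card K = r" using exists_index by blast
    have "K \<in> indices - ?J" using K fl by auto
    moreover have "clifford_monomial n K \<in> op_span (2 ^ n) (clifford_monomial n ` ?J)"
      using t F_carrier[OF K(1)] by (simp add: clifford_metric_monomials)
    ultimately have "hs_inner (clifford_monomial n K) (clifford_monomial n K) = 0"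
      using mem_span_iff[OF J] by blast
    then show False using F_orth[OF K(1) K(1)] by simp
  qed
qed

lemma level_subset: "level j \<subseteq> indices"
  by (auto simp: level_def)

text \<open>Membership at radius j kills the coordinates with more than j letters, orthogonality to
  radius \<open>j - 1\<close> those with fewer; exactly the coordinates with j letters stay
  free.\<close>

lemma layer_eq:
  assumes j: "j \<le> r"
  shows "qm_layer (2 ^ n) (clifford_metric n m) j = op_span (2 ^ n) (clifford_monomial n ` level j)"
proof (cases "j = 0")
  case True
  \<comment> \<open>Layer 0 is defined separately as the span of the identity, the monomial of the
    empty set. Finiteness is invoked because \<open>card\<close> is 0 on infinite sets too.\<close>
  have "K = {}" if "K \<in> level 0" for K
    using that finite_subset[OF indices_subset, of K] by (auto simp: level_def)
  then have "level 0 = {{}}" by (auto simp: level_def indices_def)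
  then show ?thesis using True by (simp add: qm_layer_def clifford_monomial_def)
next
  case False
  then have j1: "real j - 1 = real (j - 1)" by (simp add: of_nat_diff)
  let ?J = "{K \<in> indices. card K \<le> j}" and ?J' = "{K \<in> indices. card K \<le> j - 1}"
  have sub: "?J \<subseteq> indices" "?J' \<subseteq> indices" by auto
  have "A \<in> qm_layer (2 ^ n) (clifford_metric n m) j \<longleftrightarrow> A \<in> op_span (2 ^ n) (clifford_monomial n ` level j)" for A
  proof -
    have "A \<in> qm_layer (2 ^ n) (clifford_metric n m) j \<longleftrightarrow>
        A \<in> op_span (2 ^ n) (clifford_monomial n ` ?J) \<and>
        (\<forall>E\<in>op_span (2 ^ n) (clifford_monomial n ` ?J'). hs_inner E A = 0)"
    proof -
      have "j - 1 \<le> r" using j by simp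
      then show ?thesis
        unfolding qm_layer_def j1 metric_eq[OF j] metric_eq[OF \<open>j - 1 \<le> r\<close>] if_not_P[OF False] by blast
    qed
    also have "\<dots> \<longleftrightarrow> A \<in> carrier_mat (2 ^ n) (2 ^ n) \<and>
        (\<forall>K\<in>indices - ?J. hs_inner (clifford_monomial n K) A = 0) \<and>
        (\<forall>K\<in>?J'. hs_inner (clifford_monomial n K) A = 0)"
      using mem_span_iff[OF sub(1), of A] orthogonal_to_span_iff[OF sub(2), of A] by blast
    also have "\<dots> \<longleftrightarrow> A \<in> carrier_mat (2 ^ n) (2 ^ n) \<and>
        (\<forall>K\<in>indices - level j. hs_inner (clifford_monomial n K) A = 0)"
    proof -
      have "indices - level j = (indices - ?J) \<union> ?J'" using False by (auto simp: level_def)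
      then show ?thesis by auto
    qed
    also have "\<dots> \<longleftrightarrow> A \<in> op_span (2 ^ n) (clifford_monomial n ` level j)"
      using mem_span_iff[OF level_subset] by simp
    finally show ?thesis .
  qed
  then show ?thesis by blast
qed

text \<open>The origin of the closed formula: for \<open>t \<le> r\<close> the level consists of all
  t-element subsets of \<open>{1..m}\<close>, a sign depending only on t and \<open>card K\<close>
  factors out, and the remaining signs are summed by \<open>sum_subsets_card_Int\<close>.\<close>

lemma conjugation_sum:
  assumes t: "t \<le> r" and K: "K \<in> indices"
  shows "(\<Sum>P\<in>level t. (-1) ^ (card P * card K + card (P \<inter> K))) / 2 ^ n = complex_of_real (clifford_W t (card K))"
proof -
  have Km: "K \<subseteq> {1..m}" using K by (simp add: indices_def)
  have "level t = {P. P \<subseteq> {1..m} \<and> card P = t}" using t by (auto simp: level_def indices_def)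
  then have "(\<Sum>P\<in>level t. (-1) ^ (card P * card K + card (P \<inter> K)))
      = (-1) ^ (t * card K) * (\<Sum>P | P \<subseteq> {1..m} \<and> card P = t. (-1 :: complex) ^ card (P \<inter> K))"
    by (simp add: power_add sum_distrib_left)
  also have "(\<Sum>P | P \<subseteq> {1..m} \<and> card P = t. (-1 :: complex) ^ card (P \<inter> K))
      = (\<Sum>s=0..t. (-1) ^ s * of_nat (card K choose s) * of_nat ((m - card K) choose (t - s)))"
    using sum_subsets_card_Int[OF _ Km, where t = t and f = "\<lambda>s. (-1 :: complex) ^ s"] by simp
  finally show ?thesis by (simp add: clifford_W_def)
qed

section \<open>The maps of the Clifford metric for given bases of the layers\<close>

context
  fixes B
  assumes ob: "\<And>j. j \<le> r \<Longrightarrow> orthonormal_basis (2 ^ n) (qm_layer (2 ^ n) (clifford_metric n m) j) (B j)"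
begin

lemma error_map_eq:
  assumes t: "t \<le> r" and X: "X \<in> carrier_mat (2 ^ n) (2 ^ n)"
  shows "error_map (2 ^ n) (B t) X = op_sum (2 ^ n) (\<lambda>K. (complex_of_real (clifford_W t (card K))
    * (hs_inner (clifford_monomial n K) X / 2 ^ n)) \<cdot>\<^sub>m clifford_monomial n K) indices"
proof -
  have "orthonormal_basis (2 ^ n) (op_span (2 ^ n) (clifford_monomial n ` level t)) (B t)"
    using ob[OF t] layer_eq[OF t] by simp
  from error_map_diagonal[OF level_subset this clifford_monomial_conjugate[OF indices_subset indices_subset] X]
  have "error_map (2 ^ n) (B t) X = op_sum (2 ^ n) (\<lambda>K. ((\<Sum>P\<in>level t. (-1) ^ (card P * card K + card (P \<inter> K))) / 2 ^ n
      * (hs_inner (clifford_monomial n K) X / 2 ^ n)) \<cdot>\<^sub>m clifford_monomial n K) indices"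
    using level_subset by blast
  also have "\<dots> = op_sum (2 ^ n) (\<lambda>K. (complex_of_real (clifford_W t (card K))
    * (hs_inner (clifford_monomial n K) X / 2 ^ n)) \<cdot>\<^sub>m clifford_monomial n K) indices"
    using F_carrier by (intro op_sum_cong) (simp_all only: conjugation_sum[OF t] smult_carrier_mat)
  finally show ?thesis .
qed

text \<open>The levels up to r partition the indices and each projection keeps the coordinates of
  one level, so weighting by layer is weighting by cardinality. The weights are left general so that
  candidate coefficients can be inserted.\<close>

lemma proj_map_sum_eq:
  assumes X: "X \<in> carrier_mat (2 ^ n) (2 ^ n)"
  shows "op_sum (2 ^ n) (\<lambda>j. a j \<cdot>\<^sub>m proj_map (2 ^ n) (B j) X) {..r}
    = op_sum (2 ^ n) (\<lambda>K. (a (card K) * (hs_inner (clifford_monomial n K) X / 2 ^ n)) \<cdot>\<^sub>m clifford_monomial n K) indices"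
proof (rule op_sum_eqI)
  let ?c = "\<lambda>K. hs_inner (clifford_monomial n K) X / 2 ^ n"
  have lv: "finite (level j)" "\<And>K. K \<in> level j \<Longrightarrow> clifford_monomial n K \<in> carrier_mat (2 ^ n) (2 ^ n)" for j
    using level_subset finite_I finite_subset F_carrier by blast+
  have proj: "proj_map (2 ^ n) (B j) X = op_sum (2 ^ n) (\<lambda>K. ?c K \<cdot>\<^sub>m clifford_monomial n K) (level j)" if "j \<le> r" for j
    using proj_map_frame[OF level_subset _ X, of j "B j"] ob[OF that] layer_eq[OF that] by simp
  have proj_carrier: "proj_map (2 ^ n) (B j) X \<in> carrier_mat (2 ^ n) (2 ^ n)" if "j \<le> r" for j
    unfolding proj[OF that] using lv by (intro op_sum_carrier) auto
  then show "op_sum (2 ^ n) (\<lambda>j. a j \<cdot>\<^sub>m proj_map (2 ^ n) (B j) X) {..r} \<in> carrier_mat (2 ^ n) (2 ^ n)"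
    by (intro op_sum_carrier) auto
  show "finite indices" by (rule finite_I)
  show "(a (card K) * ?c K) \<cdot>\<^sub>m clifford_monomial n K \<in> carrier_mat (2 ^ n) (2 ^ n)" if "K \<in> indices" for K
    using F_carrier[OF that] by auto
  fix x y assume xy: "x < (2 ^ n :: nat)" "y < (2 ^ n :: nat)"
  have "op_sum (2 ^ n) (\<lambda>j. a j \<cdot>\<^sub>m proj_map (2 ^ n) (B j) X) {..r} $$ (x, y)
      = (\<Sum>j\<le>r. a j * proj_map (2 ^ n) (B j) X $$ (x, y))"
    using proj_carrier xy by (intro op_sum_smult_index) auto
  also have "\<dots> = (\<Sum>j\<le>r. \<Sum>K | K \<in> indices \<and> card K = j. a (card K) * ?c K * clifford_monomial n K $$ (x, y))"
  proof (intro sum.cong refl)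
    fix j assume "j \<in> {..r}"
    then have "proj_map (2 ^ n) (B j) X $$ (x, y) = (\<Sum>K\<in>level j. ?c K * clifford_monomial n K $$ (x, y))"
      using proj op_sum_smult_index[OF lv xy] by simp
    then show "a j * proj_map (2 ^ n) (B j) X $$ (x, y)
        = (\<Sum>K | K \<in> indices \<and> card K = j. a (card K) * ?c K * clifford_monomial n K $$ (x, y))"
      by (auto simp: level_def sum_distrib_left mult.assoc intro!: sum.cong)
  qed
  also have "\<dots> = (\<Sum>K\<in>indices. a (card K) * ?c K * clifford_monomial n K $$ (x, y))"
    by (rule sum.group) (auto simp: finite_indices indices_def)
  also have "\<dots> = (\<Sum>K\<in>indices. ((a (card K) * ?c K) \<cdot>\<^sub>m clifford_monomial n K) $$ (x, y))"
    using xy carrier_matD[OF F_carrier] by (intro sum.cong refl) simp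
  finally show "op_sum (2 ^ n) (\<lambda>j. a j \<cdot>\<^sub>m proj_map (2 ^ n) (B j) X) {..r} $$ (x, y)
      = (\<Sum>K\<in>indices. ((a (card K) * ?c K) \<cdot>\<^sub>m clifford_monomial n K) $$ (x, y))" .
qed

end

text \<open>The defining identities are tested only on self-adjoint operators, so a monomial has to
  be scaled to serve as a test operator: by 1 if it is Hermitian, by the imaginary unit if it is
  anti-Hermitian.\<close>

lemma exists_self_adjoint_multiple:
  assumes K: "K \<in> indices"
  obtains c where "c \<noteq> 0" "c \<cdot>\<^sub>m clifford_monomial n K \<in> self_adjoint (2 ^ n)"
proof -
  let ?U = "clifford_monomial n K"
  have "mat_adjoint ?U = ?U \<or> mat_adjoint ?U = (-1) \<cdot>\<^sub>m ?U"
    by (rule clifford_monomial_adjoint[OF indices_subset[OF K]])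
  then show ?thesis
  proof
    assume "mat_adjoint ?U = ?U"
    then show ?thesis using that[of 1] F_carrier[OF K] by (simp add: self_adjoint_def one_smult_mat)
  next
    assume "mat_adjoint ?U = (-1) \<cdot>\<^sub>m ?U"
    then show ?thesis using that[of \<i>] F_carrier[OF K]
      by (simp add: self_adjoint_def mat_adjoint_smult smult_smult_mat)
  qed
qed

lemma layers_have_bases:
  assumes "j \<le> r"
  shows "orthonormal_basis (2 ^ n) (qm_layer (2 ^ n) (clifford_metric n m) j)
    ((\<lambda>E. complex_of_real (1 / sqrt (2 ^ n)) \<cdot>\<^sub>m E) ` clifford_monomial n ` level j)"
proof -
  \<comment> \<open>A monomial has squared norm 2^n; the normalisation is computed over the reals
    and then transferred.\<close>
  have "1 / sqrt (2 ^ n) * (1 / sqrt (2 ^ n)) * 2 ^ n = (1 :: real)" by simp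
  then have "complex_of_real (1 / sqrt (2 ^ n) * (1 / sqrt (2 ^ n)) * 2 ^ n) = 1" by (simp only: of_real_1)
  then have "cnj (complex_of_real (1 / sqrt (2 ^ n))) * complex_of_real (1 / sqrt (2 ^ n)) * 2 ^ n = 1"
    by (simp only: complex_cnj_complex_of_real of_real_mult of_real_power of_real_numeral)
  then show ?thesis
    unfolding layer_eq[OF assms] by (rule orthonormal_basis_normalized[OF level_subset])
qed

text \<open>Both maps are diagonal in the monomials, with eigenvalues that depend only on the number
  of letters. Equal eigenvalues give equal maps; conversely, a test operator with j letters isolates
  the eigenvalue at j.\<close>

lemma is_W_coefficients_iff:
  "is_W_coefficients (2 ^ n) (clifford_metric n m) r W \<longleftrightarrow> (\<forall>t\<le>r. \<forall>j\<le>r. W t j = clifford_W t j)"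
proof
  assume W: "is_W_coefficients (2 ^ n) (clifford_metric n m) r W"
  define B where "B j = (\<lambda>E. complex_of_real (1 / sqrt (2 ^ n)) \<cdot>\<^sub>m E) ` clifford_monomial n ` level j" for j
  have ob: "orthonormal_basis (2 ^ n) (qm_layer (2 ^ n) (clifford_metric n m) j) (B j)" if "j \<le> r" for j
    unfolding B_def by (rule layers_have_bases[OF that])
  show "\<forall>t\<le>r. \<forall>j\<le>r. W t j = clifford_W t j"
  proof (intro allI impI)
    fix t j assume t: "t \<le> r" and j: "j \<le> r"
    obtain K where K: "K \<in> indices" "card K = j" using exists_index[OF j] .
    let ?U = "clifford_monomial n K"
    obtain c where c: "c \<noteq> 0" "c \<cdot>\<^sub>m ?U \<in> self_adjoint (2 ^ n)"
      using exists_self_adjoint_multiple[OF K(1)] .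
    then have X: "c \<cdot>\<^sub>m ?U \<in> carrier_mat (2 ^ n) (2 ^ n)" by (simp add: self_adjoint_def)
    have U: "hs_inner ?U (c \<cdot>\<^sub>m ?U) = c * 2 ^ n"
      using F_orth[OF K(1) K(1)] hs_inner_smult_right[OF F_carrier F_carrier, OF K(1) K(1)] by simp
    have "error_map (2 ^ n) (B t) (c \<cdot>\<^sub>m ?U)
        = op_sum (2 ^ n) (\<lambda>j. complex_of_real (W t j) \<cdot>\<^sub>m proj_map (2 ^ n) (B j) (c \<cdot>\<^sub>m ?U)) {..r}"
      using W ob t c(2) unfolding is_W_coefficients_def by blast
    \<comment> \<open>Pairing with the monomial of K extracts its coordinate, which the two sides
      multiply by \<open>clifford_W t j\<close> and \<open>W t j\<close>; the common factor is
      nonzero because \<open>c\<close> is.\<close>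
    then have "hs_inner ?U (error_map (2 ^ n) (B t) (c \<cdot>\<^sub>m ?U)) = hs_inner ?U
        (op_sum (2 ^ n) (\<lambda>j. complex_of_real (W t j) \<cdot>\<^sub>m proj_map (2 ^ n) (B j) (c \<cdot>\<^sub>m ?U)) {..r})"
      by (rule arg_cong)
    moreover have "hs_inner ?U (error_map (2 ^ n) (B t) (c \<cdot>\<^sub>m ?U)) = complex_of_real (clifford_W t j) * (c * 2 ^ n / 2 ^ n) * 2 ^ n"
      by (subst error_map_eq[OF ob t X], assumption, subst hs_inner_combination[OF K(1)]) (simp only: U K(2))
    moreover have "hs_inner ?U
        (op_sum (2 ^ n) (\<lambda>j. complex_of_real (W t j) \<cdot>\<^sub>m proj_map (2 ^ n) (B j) (c \<cdot>\<^sub>m ?U)) {..r})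
        = complex_of_real (W t j) * (c * 2 ^ n / 2 ^ n) * 2 ^ n"
      by (subst proj_map_sum_eq[OF ob X], assumption, subst hs_inner_combination[OF K(1)]) (simp only: U K(2))
    ultimately
    have "complex_of_real (clifford_W t j) * (c * 2 ^ n / 2 ^ n) * 2 ^ n = complex_of_real (W t j) * (c * 2 ^ n / 2 ^ n) * 2 ^ n"
      by simp
    then show "W t j = clifford_W t j" using c(1) by simp
  qed
next
  assume W: "\<forall>t\<le>r. \<forall>j\<le>r. W t j = clifford_W t j"
  show "is_W_coefficients (2 ^ n) (clifford_metric n m) r W"
    unfolding is_W_coefficients_def
  proof (intro allI impI ballI)
    fix B t X
    assume "\<forall>j\<le>r. orthonormal_basis (2 ^ n) (qm_layer (2 ^ n) (clifford_metric n m) j) (B j)"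
      and t: "t \<le> r" and "X \<in> self_adjoint (2 ^ n)"
    then have ob: "\<And>j. j \<le> r \<Longrightarrow> orthonormal_basis (2 ^ n) (qm_layer (2 ^ n) (clifford_metric n m) j) (B j)"
      and X: "X \<in> carrier_mat (2 ^ n) (2 ^ n)" by (auto simp: self_adjoint_def)
    show "error_map (2 ^ n) (B t) X
        = op_sum (2 ^ n) (\<lambda>j. complex_of_real (W t j) \<cdot>\<^sub>m proj_map (2 ^ n) (B j) X) {..r}"
    proof (subst error_map_eq[OF ob t X], assumption, subst proj_map_sum_eq[OF ob X], assumption,
        rule op_sum_cong)
      fix K assume K: "K \<in> indices"
      then have "W t (card K) = clifford_W t (card K)" using W t by (auto simp: indices_def)
      then show "(complex_of_real (clifford_W t (card K)) * (hs_inner (clifford_monomial n K) X / 2 ^ n)) \<cdot>\<^sub>m clifford_monomial n K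
          = (complex_of_real (W t (card K)) * (hs_inner (clifford_monomial n K) X / 2 ^ n)) \<cdot>\<^sub>m clifford_monomial n K"
        by simp
    qed (use F_carrier in auto)
  qed
qed

end

theorem proposition3p6p3:
  fixes n m r :: nat
  assumes "1 \<le> n"
    and "m \<in> {2 * n, 2 * n + 1}"
    and "r = (if m = 2 * n then 2 * n else n)"
  shows "qm_diameter (2 ^ n) (clifford_metric n m) = real r \<and>
    (\<forall>W. is_W_coefficients (2 ^ n) (clifford_metric n m) r W \<longleftrightarrow>
      (\<forall>t\<le>r. \<forall>j\<le>r.
         W t j = (-1) ^ (t * j) / 2 ^ n *
           (\<Sum>s=0..t. (-1) ^ s * real (j choose s) * real ((m - j) choose (t - s)))))"
proof -
  interpret clifford_parameters n m r
    using assms(2,3) by unfold_locales auto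
  show ?thesis using diameter is_W_coefficients_iff by (simp add: clifford_W_def)
qed

end
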